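(* Let $\Bbbk$ be a field, $(A,\Delta,\varepsilon)$ a cocommutative $\Bbbk$-bialgebra, and $V$ an $A$-module. Let $\lambda:A\otimes V\to A$ and $\kappa=\kappa_V\oplus\kappa_A:V\wedge V\to V\oplus A$ be $\Bbbk$-linear with $\kappa_V=0$, and suppose $\mathscr{H}_{\lambda,\kappa}$ has the PBW property. Let $0\neq a'\in A$, and suppose there exist a nonzero $a''\in A$ and a vector space complement $U$ to $\Bbbk a''$ in $A$ such that $$\Delta(\operatorname{im}\kappa_A)\subset\Bbbk(a'\otimes a'')\oplus(A\otimes U),\qquad\text{but}\qquad\Delta(\operatorname{im}\kappa_A)\not\subseteq A\otimes U.$$ Then the operator $a'-\varepsilon(a')\in\operatorname{End}_\Bbbk V$ has image of dimension at most $2$.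
   Context: Sweedler notation: $\Delta(a)=\sum a_{(1)}\otimes a_{(2)}$. The action of $a\in A$ on $v\in V$ is written $a(v)$. $V\wedge V\subset V\otimes V$ is the span of the $v\wedge v'=v\otimes v'-v'\otimes v$; $\kappa(v,v')=\kappa(v\wedge v')$. $\mathscr{H}_{\lambda,\kappa}$ is the quotient of the tensor algebra $T(V\oplus A)$ by the multiplication in $A$ (with $1_A$ the unit) and by the relations $av-\sum a_{(1)}(v)a_{(2)}=\lambda(a,v)$ and $vv'-v'v=\kappa(v,v')$ for $a\in A$, $v,v'\in V$. It is filtered by $\deg A=0$, $\deg V=1$. $\mathscr{H}_{0,0}=\mathrm{Sym}(V)\rtimes A$ is the smash product: $\mathrm{Sym}(V)\otimes A$ with $(f'\otimes a')(f\otimes a)=\sum f'a'_{(1)}(f)\otimes a'_{(2)}a$, where $A$ acts on $\mathrm{Sym}(V)$ via the coproduct (and counit). $\mathscr{H}_{\lambda,\kappa}$ has the PBW property if the natural surjection from $\mathscr{H}_{0,0}$ onto its associated graded algebra is an isomorphism (equivalently, ordered monomials in a totally ordered basis of $V$ times basis elements of $A$ form a basis of $\mathscr{H}_{\lambda,\kappa}$). *)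

theory Defs
  imports
    Complex_Main
    "HOL-Algebra.QuotRing"
    "HOL-Library.Poly_Mapping"
    "HOL-Library.Product_Plus"
    "HOL-Library.Set_Algebras"
begin

section \<open>Free vector spaces\<close>

text \<open>The free \<open>'k\<close>-vector space on the type \<open>'x\<close> is \<open>'x \<Rightarrow>\<^sub>0 'k\<close>, with basis vectors \<open>gen x\<close>.\<close>

definition fscale :: "'k::field \<Rightarrow> ('x \<Rightarrow>\<^sub>0 'k) \<Rightarrow> ('x \<Rightarrow>\<^sub>0 'k)" where
  "fscale c f = Poly_Mapping.map ((*) c) f"

abbreviation gen :: "'x \<Rightarrow> ('x \<Rightarrow>\<^sub>0 'k::field)" where
  "gen x \<equiv> Poly_Mapping.single x 1"

lemma lookup_fscale [simp]: "Poly_Mapping.lookup (fscale c f) x = c * Poly_Mapping.lookup f x"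
  by (simp add: fscale_def Poly_Mapping.map.rep_eq when_def)

global_interpretation free_vs: vector_space "fscale :: 'k::field \<Rightarrow> ('x \<Rightarrow>\<^sub>0 'k) \<Rightarrow> ('x \<Rightarrow>\<^sub>0 'k)"
  by unfold_locales (auto intro!: poly_mapping_eqI simp: lookup_add algebra_simps)

text \<open>The linear extension of a map \<open>h\<close> on basis vectors to the free vector space.\<close>

definition free_ext :: "('k::field \<Rightarrow> 'm \<Rightarrow> 'm) \<Rightarrow> ('x \<Rightarrow> 'm::ab_group_add) \<Rightarrow> ('x \<Rightarrow>\<^sub>0 'k) \<Rightarrow> 'm" where
  "free_ext s h d = (\<Sum>x\<in>Poly_Mapping.keys d. s (Poly_Mapping.lookup d x) (h x))"


section \<open>Tensor products\<close>

text \<open>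
  The tensor product of two vector spaces is the free vector space on the pairs modulo the
  bilinearity relations; its elements are cosets, added by the elementwise sum of sets from
  \<^theory>\<open>HOL-Library.Set_Algebras\<close>.
  A member \<open>d\<close> of a coset \<open>X\<close> is an expression of \<open>X\<close> as a sum of pure tensors, the summand
  at the pair \<open>(x, y)\<close> being \<open>lookup d (x, y)\<close> times \<open>x \<otimes> y\<close>.
\<close>

definition tensor_rel ::
  "('k::field \<Rightarrow> 'a::ab_group_add \<Rightarrow> 'a) \<Rightarrow> ('k \<Rightarrow> 'b::ab_group_add \<Rightarrow> 'b) \<Rightarrow> ('a \<times> 'b \<Rightarrow>\<^sub>0 'k) set" where
  "tensor_rel s t = free_vs.span
     ({gen (x + x', y) - gen (x, y) - gen (x', y) | x x' y. True} \<union>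
      {gen (x, y + y') - gen (x, y) - gen (x, y') | x y y'. True} \<union>
      {gen (s c x, y) - fscale c (gen (x, y)) | c x y. True} \<union>
      {gen (x, t c y) - fscale c (gen (x, y)) | c x y. True})"

definition tensor_class ::
  "('k::field \<Rightarrow> 'a::ab_group_add \<Rightarrow> 'a) \<Rightarrow> ('k \<Rightarrow> 'b::ab_group_add \<Rightarrow> 'b) \<Rightarrow>
   ('a \<times> 'b \<Rightarrow>\<^sub>0 'k) \<Rightarrow> ('a \<times> 'b \<Rightarrow>\<^sub>0 'k) set" where
  "tensor_class s t f = {g. g - f \<in> tensor_rel s t}"

definition pure_tensor ::
  "('k::field \<Rightarrow> 'a::ab_group_add \<Rightarrow> 'a) \<Rightarrow> ('k \<Rightarrow> 'b::ab_group_add \<Rightarrow> 'b) \<Rightarrow>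
   'a \<Rightarrow> 'b \<Rightarrow> ('a \<times> 'b \<Rightarrow>\<^sub>0 'k) set" where
  "pure_tensor s t x y = tensor_class s t (gen (x, y))"

text \<open>The subspace of the tensor product spanned by the classes of the elements of \<open>S\<close>.\<close>

definition tensor_span ::
  "('k::field \<Rightarrow> 'a::ab_group_add \<Rightarrow> 'a) \<Rightarrow> ('k \<Rightarrow> 'b::ab_group_add \<Rightarrow> 'b) \<Rightarrow>
   ('a \<times> 'b \<Rightarrow>\<^sub>0 'k) set \<Rightarrow> ('a \<times> 'b \<Rightarrow>\<^sub>0 'k) set set" where
  "tensor_span s t S = tensor_class s t ` free_vs.span S"

text \<open>For subspaces \<open>X\<close>, \<open>Y\<close>, the subspace \<open>X \<otimes> Y\<close> of the tensor product.\<close>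

definition tensor_sub ::
  "('k::field \<Rightarrow> 'a::ab_group_add \<Rightarrow> 'a) \<Rightarrow> ('k \<Rightarrow> 'b::ab_group_add \<Rightarrow> 'b) \<Rightarrow>
   'a set \<Rightarrow> 'b set \<Rightarrow> ('a \<times> 'b \<Rightarrow>\<^sub>0 'k) set set" where
  "tensor_sub s t X Y = tensor_span s t {gen (x, y) | x y. x \<in> X \<and> y \<in> Y}"

definition wedge :: "('k::field \<Rightarrow> 'v::ab_group_add \<Rightarrow> 'v) \<Rightarrow> 'v \<Rightarrow> 'v \<Rightarrow> ('v \<times> 'v \<Rightarrow>\<^sub>0 'k) set" where
  "wedge s v w = tensor_class s s (gen (v, w) - gen (w, v))"

definition wedge_space :: "('k::field \<Rightarrow> 'v::ab_group_add \<Rightarrow> 'v) \<Rightarrow> ('v \<times> 'v \<Rightarrow>\<^sub>0 'k) set set" where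
  "wedge_space s = tensor_span s s {gen (v, w) - gen (w, v) | v w. True}"

text \<open>Linearity, on a subspace \<open>W\<close> of a tensor product, of a map into a space with scaling \<open>r\<close>.\<close>

definition tensor_linear_on ::
  "('k::field \<Rightarrow> 'a::ab_group_add \<Rightarrow> 'a) \<Rightarrow> ('k \<Rightarrow> 'b::ab_group_add \<Rightarrow> 'b) \<Rightarrow>
   ('a \<times> 'b \<Rightarrow>\<^sub>0 'k) set set \<Rightarrow> ('k \<Rightarrow> 'm::ab_group_add \<Rightarrow> 'm) \<Rightarrow>
   (('a \<times> 'b \<Rightarrow>\<^sub>0 'k) set \<Rightarrow> 'm) \<Rightarrow> bool" where
  "tensor_linear_on s t W r h \<longleftrightarrow>
     (\<forall>X\<in>W. \<forall>Y\<in>W. h (X + Y) = h X + h Y) \<and>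
     (\<forall>c. \<forall>X\<in>W. \<forall>f\<in>X. h (tensor_class s t (fscale c f)) = r c (h X))"

text \<open>The relations defining the threefold tensor power.\<close>

definition tensor3_rel :: "('k::field \<Rightarrow> 'a::ab_group_add \<Rightarrow> 'a) \<Rightarrow> ('a \<times> 'a \<times> 'a \<Rightarrow>\<^sub>0 'k) set" where
  "tensor3_rel s = free_vs.span
     ({gen (x + x', y, z) - gen (x, y, z) - gen (x', y, z) | x x' y z. True} \<union>
      {gen (x, y + y', z) - gen (x, y, z) - gen (x, y', z) | x y y' z. True} \<union>
      {gen (x, y, z + z') - gen (x, y, z) - gen (x, y, z') | x y z z'. True} \<union>
      {gen (s c x, y, z) - fscale c (gen (x, y, z)) | c x y z. True} \<union>
      {gen (x, s c y, z) - fscale c (gen (x, y, z)) | c x y z. True} \<union>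
      {gen (x, y, s c z) - fscale c (gen (x, y, z)) | c x y z. True})"


section \<open>Bialgebras and their modules\<close>

locale unital_algebra = vector_space scale
  for scale :: "'k::field \<Rightarrow> 'a::ring_1 \<Rightarrow> 'a" +
  assumes scale_mult_left: "scale c x * y = scale c (x * y)"
    and scale_mult_right: "x * scale c y = scale c (x * y)"

text \<open>
  The coproduct takes values in the tensor square. In each axiom \<open>d \<in> \<Delta> a\<close> is a Sweedler
  expression of \<open>\<Delta> a\<close>; in coassociativity \<open>r\<close> picks such an expression of \<open>\<Delta> x\<close> for every
  \<open>x\<close>, and the two sums are \<open>(\<Delta> \<otimes> id) (\<Delta> a)\<close> and \<open>(id \<otimes> \<Delta>) (\<Delta> a)\<close>.
\<close>

locale bialgebra = unital_algebra scale
  for scale :: "'k::field \<Rightarrow> 'a::ring_1 \<Rightarrow> 'a" +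
  fixes \<Delta> :: "'a \<Rightarrow> ('a \<times> 'a \<Rightarrow>\<^sub>0 'k) set"
    and \<epsilon> :: "'a \<Rightarrow> 'k"
  assumes counit_linear: "Vector_Spaces.linear scale (*) \<epsilon>"
    and counit_one: "\<epsilon> 1 = 1"
    and counit_mult: "\<epsilon> (a * b) = \<epsilon> a * \<epsilon> b"
    and coprod_tensor: "\<Delta> a \<in> range (tensor_class scale scale)"
    and coprod_add: "\<Delta> (a + b) = \<Delta> a + \<Delta> b"
    and coprod_scale: "d \<in> \<Delta> a \<Longrightarrow> fscale c d \<in> \<Delta> (scale c a)"
    and coprod_one: "\<Delta> 1 = pure_tensor scale scale 1 1"
    and coprod_mult: "d \<in> \<Delta> a \<Longrightarrow> e \<in> \<Delta> b \<Longrightarrow>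
          free_ext fscale (\<lambda>(x, y). free_ext fscale (\<lambda>(x', y'). gen (x * x', y * y')) e) d
            \<in> \<Delta> (a * b)"
    and counit_left: "d \<in> \<Delta> a \<Longrightarrow> free_ext scale (\<lambda>(x, y). scale (\<epsilon> x) y) d = a"
    and counit_right: "d \<in> \<Delta> a \<Longrightarrow> free_ext scale (\<lambda>(x, y). scale (\<epsilon> y) x) d = a"
    and coassoc: "d \<in> \<Delta> a \<Longrightarrow> (\<And>x. r x \<in> \<Delta> x) \<Longrightarrow>
          free_ext fscale (\<lambda>(x, y). free_ext fscale (\<lambda>(p, q). gen (p, q, y)) (r x)) d
          - free_ext fscale (\<lambda>(x, y). free_ext fscale (\<lambda>(p, q). gen (x, p, q)) (r y)) d
            \<in> tensor3_rel scale"

locale cocommutative_bialgebra = bialgebra +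
  assumes cocomm: "d \<in> \<Delta> a \<Longrightarrow> free_ext fscale (\<lambda>(x, y). gen (y, x)) d \<in> \<Delta> a"

locale algebra_module = A: unital_algebra sA + V: vector_space sV
  for sA :: "'k::field \<Rightarrow> 'a::ring_1 \<Rightarrow> 'a"
    and sV :: "'k \<Rightarrow> 'v::ab_group_add \<Rightarrow> 'v" +
  fixes act :: "'a \<Rightarrow> 'v \<Rightarrow> 'v"
  assumes act_linear: "Vector_Spaces.linear sV sV (act a)"
    and act_add: "act (a + b) v = act a v + act b v"
    and act_scale: "act (sA c a) v = sV c (act a v)"
    and act_one: "act 1 v = v"
    and act_mult: "act (a * b) v = act a (act b v)"


section \<open>The tensor algebra\<close>

datatype 'x fword = FWord (letters: "'x list")

instantiation fword :: (type) monoid_add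
begin

definition zero_fword :: "'a fword" where
  "0 = FWord []"

definition plus_fword :: "'a fword \<Rightarrow> 'a fword \<Rightarrow> 'a fword" where
  "u + w = FWord (letters u @ letters w)"

instance
  by standard (simp_all add: zero_fword_def plus_fword_def)

end

text \<open>
  The free algebra on \<open>'x\<close> is the monoid algebra \<open>'x fword \<Rightarrow>\<^sub>0 'k\<close> of the free monoid. The tensor
  algebra of a vector space is the free algebra on its elements modulo the linear relations
  between them. Ideals are two-sided.
\<close>

definition free_algebra :: "('x fword \<Rightarrow>\<^sub>0 'k::field) ring" where
  "free_algebra = \<lparr>carrier = UNIV, mult = (*), one = 1, zero = 0, add = (+)\<rparr>"

definition linear_rels ::
  "('k::field \<Rightarrow> 'x::ab_group_add \<Rightarrow> 'x) \<Rightarrow> ('x fword \<Rightarrow>\<^sub>0 'k) set" where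
  "linear_rels s =
     {gen (FWord [x + y]) - gen (FWord [x]) - gen (FWord [y]) | x y. True} \<union>
     {gen (FWord [s c x]) - fscale c (gen (FWord [x])) | c x. True}"

definition tensor_algebra ::
  "('k::field \<Rightarrow> 'x::ab_group_add \<Rightarrow> 'x) \<Rightarrow> ('x fword \<Rightarrow>\<^sub>0 'k) set ring" where
  "tensor_algebra s = free_algebra Quot (Idl\<^bsub>free_algebra\<^esub> linear_rels s)"

definition tensor_algebra_class ::
  "('k::field \<Rightarrow> 'x::ab_group_add \<Rightarrow> 'x) \<Rightarrow> ('x fword \<Rightarrow>\<^sub>0 'k) \<Rightarrow> ('x fword \<Rightarrow>\<^sub>0 'k) set" where
  "tensor_algebra_class s f = (Idl\<^bsub>free_algebra\<^esub> linear_rels s) +>\<^bsub>free_algebra\<^esub> f"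

definition tensor_incl ::
  "('k::field \<Rightarrow> 'x::ab_group_add \<Rightarrow> 'x) \<Rightarrow> 'x \<Rightarrow> ('x fword \<Rightarrow>\<^sub>0 'k) set" where
  "tensor_incl s x = tensor_algebra_class s (gen (FWord [x]))"


section \<open>The algebras \<open>\<H>\<close>\<close>

text \<open>The direct sum of \<open>V\<close> and \<open>A\<close> is the product type, \<open>(v, 0)\<close> and \<open>(0, a)\<close> being the summands.\<close>

definition sum_scale ::
  "('k \<Rightarrow> 'v \<Rightarrow> 'v) \<Rightarrow> ('k \<Rightarrow> 'a \<Rightarrow> 'a) \<Rightarrow> 'k \<Rightarrow> 'v \<times> 'a \<Rightarrow> 'v \<times> 'a" where
  "sum_scale sV sA c p = (sV c (fst p), sA c (snd p))"

text \<open>In the third family \<open>d\<close> is a Sweedler expression of \<open>\<Delta> a\<close>.\<close>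

definition hecke_rels ::
  "('k::field \<Rightarrow> 'a::ring_1 \<Rightarrow> 'a) \<Rightarrow> ('a \<Rightarrow> ('a \<times> 'a \<Rightarrow>\<^sub>0 'k) set) \<Rightarrow>
   ('k \<Rightarrow> 'v::ab_group_add \<Rightarrow> 'v) \<Rightarrow> ('a \<Rightarrow> 'v \<Rightarrow> 'v) \<Rightarrow>
   (('a \<times> 'v \<Rightarrow>\<^sub>0 'k) set \<Rightarrow> 'a) \<Rightarrow> (('v \<times> 'v \<Rightarrow>\<^sub>0 'k) set \<Rightarrow> 'v \<times> 'a) \<Rightarrow>
   (('v \<times> 'a) fword \<Rightarrow>\<^sub>0 'k) set set" where
  "hecke_rels sA \<Delta> sV act lam kap =
    (let T = tensor_algebra (sum_scale sV sA);
         \<iota> = tensor_incl (sum_scale sV sA);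
         \<iota>A = (\<lambda>a. \<iota> (0, a));
         \<iota>V = (\<lambda>v. \<iota> (v, 0))
     in {\<iota>A a \<otimes>\<^bsub>T\<^esub> \<iota>A b \<ominus>\<^bsub>T\<^esub> \<iota>A (a * b) | a b. True} \<union>
        {\<iota>A 1 \<ominus>\<^bsub>T\<^esub> \<one>\<^bsub>T\<^esub>} \<union>
        {\<iota>A a \<otimes>\<^bsub>T\<^esub> \<iota>V v
           \<ominus>\<^bsub>T\<^esub> (\<Oplus>\<^bsub>T\<^esub>p\<in>Poly_Mapping.keys d.
                 \<iota>V (sV (Poly_Mapping.lookup d p) (act (fst p) v)) \<otimes>\<^bsub>T\<^esub> \<iota>A (snd p))
           \<ominus>\<^bsub>T\<^esub> \<iota>A (lam (pure_tensor sA sV a v)) | a v d. d \<in> \<Delta> a} \<union>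
        {\<iota>V v \<otimes>\<^bsub>T\<^esub> \<iota>V w \<ominus>\<^bsub>T\<^esub> \<iota>V w \<otimes>\<^bsub>T\<^esub> \<iota>V v \<ominus>\<^bsub>T\<^esub> \<iota> (kap (wedge sV v w)) | v w. True})"

definition hecke_algebra ::
  "('k::field \<Rightarrow> 'a::ring_1 \<Rightarrow> 'a) \<Rightarrow> ('a \<Rightarrow> ('a \<times> 'a \<Rightarrow>\<^sub>0 'k) set) \<Rightarrow>
   ('k \<Rightarrow> 'v::ab_group_add \<Rightarrow> 'v) \<Rightarrow> ('a \<Rightarrow> 'v \<Rightarrow> 'v) \<Rightarrow>
   (('a \<times> 'v \<Rightarrow>\<^sub>0 'k) set \<Rightarrow> 'a) \<Rightarrow> (('v \<times> 'v \<Rightarrow>\<^sub>0 'k) set \<Rightarrow> 'v \<times> 'a) \<Rightarrow>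
   (('v \<times> 'a) fword \<Rightarrow>\<^sub>0 'k) set set ring" where
  "hecke_algebra sA \<Delta> sV act lam kap =
    (let T = tensor_algebra (sum_scale sV sA)
     in T Quot (Idl\<^bsub>T\<^esub> hecke_rels sA \<Delta> sV act lam kap))"

definition hecke_class ::
  "('k::field \<Rightarrow> 'a::ring_1 \<Rightarrow> 'a) \<Rightarrow> ('a \<Rightarrow> ('a \<times> 'a \<Rightarrow>\<^sub>0 'k) set) \<Rightarrow>
   ('k \<Rightarrow> 'v::ab_group_add \<Rightarrow> 'v) \<Rightarrow> ('a \<Rightarrow> 'v \<Rightarrow> 'v) \<Rightarrow>
   (('a \<times> 'v \<Rightarrow>\<^sub>0 'k) set \<Rightarrow> 'a) \<Rightarrow> (('v \<times> 'v \<Rightarrow>\<^sub>0 'k) set \<Rightarrow> 'v \<times> 'a) \<Rightarrow>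
   (('v \<times> 'a) fword \<Rightarrow>\<^sub>0 'k) \<Rightarrow> (('v \<times> 'a) fword \<Rightarrow>\<^sub>0 'k) set set" where
  "hecke_class sA \<Delta> sV act lam kap f =
    (let T = tensor_algebra (sum_scale sV sA)
     in (Idl\<^bsub>T\<^esub> hecke_rels sA \<Delta> sV act lam kap) +>\<^bsub>T\<^esub> tensor_algebra_class (sum_scale sV sA) f)"

text \<open>
  The filtration with \<open>A\<close> in degree 0 and \<open>V\<close> in degree 1. A letter \<open>(v, a)\<close> with \<open>v \<noteq> 0\<close> is the
  sum of \<open>(v, 0)\<close> and \<open>(0, a)\<close> in the tensor algebra, hence counts as degree 1.
\<close>

definition V_degree :: "('v::zero \<times> 'a) fword \<Rightarrow> nat" where
  "V_degree w = length (filter (\<lambda>x. fst x \<noteq> 0) (letters w))"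

definition hecke_filtration ::
  "('k::field \<Rightarrow> 'a::ring_1 \<Rightarrow> 'a) \<Rightarrow> ('a \<Rightarrow> ('a \<times> 'a \<Rightarrow>\<^sub>0 'k) set) \<Rightarrow>
   ('k \<Rightarrow> 'v::ab_group_add \<Rightarrow> 'v) \<Rightarrow> ('a \<Rightarrow> 'v \<Rightarrow> 'v) \<Rightarrow>
   (('a \<times> 'v \<Rightarrow>\<^sub>0 'k) set \<Rightarrow> 'a) \<Rightarrow> (('v \<times> 'v \<Rightarrow>\<^sub>0 'k) set \<Rightarrow> 'v \<times> 'a) \<Rightarrow>
   nat \<Rightarrow> (('v \<times> 'a) fword \<Rightarrow>\<^sub>0 'k) set set set" where
  "hecke_filtration sA \<Delta> sV act lam kap n =
    hecke_class sA \<Delta> sV act lam kap ` {f. \<forall>w\<in>Poly_Mapping.keys f. V_degree w \<le> n}"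


section \<open>Associated graded rings and the PBW property\<close>

text \<open>
  For a filtered ring \<open>R\<close> with filtration \<open>F\<close>, an element of the associated graded ring is a
  finitely supported family \<open>X\<close> with \<open>X n\<close> in \<open>F n / F (n - 1)\<close>, where \<open>F (-1) = 0\<close>.
\<close>

definition filt_below :: "('r, 'm) ring_scheme \<Rightarrow> (nat \<Rightarrow> 'r set) \<Rightarrow> nat \<Rightarrow> 'r set" where
  "filt_below R F n = (case n of 0 \<Rightarrow> {\<zero>\<^bsub>R\<^esub>} | Suc m \<Rightarrow> F m)"

definition homog :: "('r, 'm) ring_scheme \<Rightarrow> (nat \<Rightarrow> 'r set) \<Rightarrow> nat \<Rightarrow> 'r \<Rightarrow> nat \<Rightarrow> 'r set" where
  "homog R F d x = (\<lambda>n. if n = d then filt_below R F n +>\<^bsub>R\<^esub> x else filt_below R F n)"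

definition assoc_graded :: "('r, 'm) ring_scheme \<Rightarrow> (nat \<Rightarrow> 'r set) \<Rightarrow> (nat \<Rightarrow> 'r set) ring" where
  "assoc_graded R F =
    \<lparr>carrier = {X. (\<forall>n. \<exists>x\<in>F n. X n = filt_below R F n +>\<^bsub>R\<^esub> x) \<and>
                   finite {n. X n \<noteq> filt_below R F n}},
     mult = (\<lambda>X Y n. \<Union>{filt_below R F n +>\<^bsub>R\<^esub> (\<Oplus>\<^bsub>R\<^esub>i\<in>{..n}. x i \<otimes>\<^bsub>R\<^esub> y (n - i)) | x y.
                       (\<forall>i. x i \<in> X i) \<and> (\<forall>i. y i \<in> Y i)}),
     one = homog R F 0 \<one>\<^bsub>R\<^esub>,
     zero = filt_below R F,
     add = (\<lambda>X Y n. X n <+>\<^bsub>R\<^esub> Y n)\<rparr>"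

text \<open>
  The natural map from \<open>\<H>\<^bsub>0,0\<^esub>\<close> to the associated graded ring is the ring homomorphism sending
  the generators \<open>v\<close> and \<open>a\<close> to their classes in degrees 1 and 0. These values determine it, so
  it is an isomorphism iff some ring isomorphism takes them.
\<close>

definition PBW_property ::
  "('k::field \<Rightarrow> 'a::ring_1 \<Rightarrow> 'a) \<Rightarrow> ('a \<Rightarrow> ('a \<times> 'a \<Rightarrow>\<^sub>0 'k) set) \<Rightarrow>
   ('k \<Rightarrow> 'v::ab_group_add \<Rightarrow> 'v) \<Rightarrow> ('a \<Rightarrow> 'v \<Rightarrow> 'v) \<Rightarrow>
   (('a \<times> 'v \<Rightarrow>\<^sub>0 'k) set \<Rightarrow> 'a) \<Rightarrow> (('v \<times> 'v \<Rightarrow>\<^sub>0 'k) set \<Rightarrow> 'v \<times> 'a) \<Rightarrow> bool" where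
  "PBW_property sA \<Delta> sV act lam kap \<longleftrightarrow>
    (let H0 = hecke_algebra sA \<Delta> sV act (\<lambda>_. 0) (\<lambda>_. (0, 0));
         g0 = (\<lambda>x. hecke_class sA \<Delta> sV act (\<lambda>_. 0) (\<lambda>_. (0, 0)) (gen (FWord [x])));
         H = hecke_algebra sA \<Delta> sV act lam kap;
         g = (\<lambda>x. hecke_class sA \<Delta> sV act lam kap (gen (FWord [x])));
         F = hecke_filtration sA \<Delta> sV act lam kap
     in \<exists>\<phi>\<in>ring_iso H0 (assoc_graded H F).
          (\<forall>v. \<phi> (g0 (v, 0)) = homog H F 1 (g (v, 0))) \<and>
          (\<forall>a. \<phi> (g0 (0, a)) = homog H F 0 (g (0, a))))"

end

theory Submission
  imports Defs "HOL-Library.Function_Algebras" "HOL-Algebra.Multiplicative_Group"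
begin

text \<open>
  Write \<open>k(v,w) \<in> A\<close> for the \<open>A\<close>-component of \<open>\<kappa>(v,w)\<close>. As \<open>\<kappa>\<close> has no \<open>V\<close>-component, \<open>[v,w] = k(v,w)\<close>
  in \<open>\<H>\<close>, and the Jacobi identity for the commutators of \<open>x, y, z \<in> V\<close> says that the cyclic sum
  of \<open>x k(y,z) - k(y,z) x\<close> vanishes. Moving \<open>x\<close> to the left of \<open>k(y,z)\<close> turns the summand into
  \<open>x k(y,z) - \<Sum> k(y,z)\<^sub>1(x) k(y,z)\<^sub>2\<close>, of filtration degree 1, minus a value of \<open>\<lambda>\<close>, of degree 0.
  By PBW the part of degree 1 already vanishes in the smash product \<open>Sym(V) \<rtimes> A\<close>
  (\<open>PBW_detects_degree_one\<close>, \<open>jacobi_in_smash_product\<close>), whose part of degree 1 is \<open>V \<otimes> A\<close>.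

  Let \<open>f\<close> be the linear form on \<open>A\<close> that vanishes on \<open>U\<close> and takes the value 1 at \<open>a''\<close>. Write
  \<open>\<Delta>(k(v,w)) = c(v,w) a' \<otimes> a''\<close> modulo \<open>A \<otimes> U\<close>. Applying the counit to the left factor and \<open>f\<close> to the
  right one gives \<open>f(k(v,w)) = c(v,w) \<epsilon>(a')\<close>. Hence \<open>id \<otimes> f\<close> turns the identity in \<open>V \<otimes> A\<close> into
  \<open>c(y,z) D(x) + c(z,x) D(y) + c(x,y) D(z) = 0\<close> with \<open>D = a' - \<epsilon>(a')\<close>. The image of \<open>\<Delta> \<circ> \<kappa>\<^sub>A\<close> is not in
  \<open>A \<otimes> U\<close>, so \<open>c(y,z) \<noteq> 0\<close> for some \<open>y\<close> and \<open>z\<close>; then \<open>D(y)\<close> and \<open>D(z)\<close> span the image of \<open>D\<close>.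

  It remains to see that \<open>v a \<mapsto> f(a) v\<close> is well defined on the smash product, which is presented by
  generators and relations. For this the generators act on the truncation \<open>A \<oplus> (V \<otimes> A)\<close> of the
  smash product (\<open>hecke_ideal_annihilates\<close>); the map is read off from the image of 1 under this
  action (\<open>degree_one_part_hecke_ideal\<close>).
\<close>

section \<open>The free algebra\<close>

abbreviation letter :: "'x \<Rightarrow> ('x fword \<Rightarrow>\<^sub>0 'k::field)" where
  "letter x \<equiv> gen (FWord [x])"

lemma free_algebra_simps [simp]:
  "carrier free_algebra = UNIV" "mult free_algebra = (*)" "one free_algebra = 1"
  "zero free_algebra = 0" "add free_algebra = (+)"
  by (simp_all add: free_algebra_def)

lemma ring_free_algebra: "ring (free_algebra :: ('x fword \<Rightarrow>\<^sub>0 'k::field) ring)"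
proof (rule ringI)
  show "abelian_group (free_algebra :: ('x fword \<Rightarrow>\<^sub>0 'k::field) ring)"
    by (rule abelian_groupI) (auto simp: algebra_simps intro: exI[of _ "- x" for x])
  show "Group.monoid (free_algebra :: ('x fword \<Rightarrow>\<^sub>0 'k::field) ring)"
    by (rule Group.monoidI) (auto simp: algebra_simps)
qed (auto simp: algebra_simps)

interpretation FA: ring free_algebra by (rule ring_free_algebra)

lemma a_inv_free_algebra: "\<ominus>\<^bsub>free_algebra\<^esub> f = - f"
  using FA.minus_equality[of "- f" f] by simp

lemma ideal_free_algebraI:
  fixes J :: "('x fword \<Rightarrow>\<^sub>0 'k::field) set"
  assumes "0 \<in> J" "\<And>f g. f \<in> J \<Longrightarrow> g \<in> J \<Longrightarrow> f - g \<in> J"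
    and "\<And>f g. f \<in> J \<Longrightarrow> f * g \<in> J" "\<And>f g. f \<in> J \<Longrightarrow> g * f \<in> J"
  shows "ideal J free_algebra"
proof (rule idealI[OF ring_free_algebra])
  have neg: "- f \<in> J" if "f \<in> J" for f
    using assms(2)[OF assms(1) that] by simp
  have add: "f + g \<in> J" if "f \<in> J" "g \<in> J" for f g
    using assms(2)[OF that(1) neg[OF that(2)]] by simp
  have ai: "inv\<^bsub>add_monoid free_algebra\<^esub> f = - f" for f :: "('x fword \<Rightarrow>\<^sub>0 'k::field)"
    using a_inv_free_algebra[of f] by (simp add: a_inv_def)
  show "subgroup J (add_monoid free_algebra)"
    by (unfold_locales; insert assms(1) neg add; simp add: ai[simplified])
qed (use assms(3,4) in auto)

lemma hom_finsum:
  fixes b :: "'i \<Rightarrow> ('x fword \<Rightarrow>\<^sub>0 'k::field)"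
  assumes S: "ring S" and h: "h \<in> ring_hom free_algebra S" and "finite I"
  shows "h (\<Sum>i\<in>I. b i) = (\<Oplus>\<^bsub>S\<^esub>i\<in>I. h (b i))"
proof -
  interpret S: ring S by fact
  have c: "h f \<in> carrier S" for f using ring_hom_closed[OF h] by simp
  have z: "h 0 = \<zero>\<^bsub>S\<^esub>" using ring_hom_zero[OF h ring_free_algebra S] by simp
  show ?thesis using \<open>finite I\<close>
    by induction (use c z ring_hom_add[OF h] in simp_all)
qed

lemma hom_minus:
  fixes f :: "('x fword \<Rightarrow>\<^sub>0 'k::field)"
  assumes S: "ring S" and h: "h \<in> ring_hom free_algebra S"
  shows "h (f - g) = h f \<ominus>\<^bsub>S\<^esub> h g"
proof -
  interpret S: ring S by fact
  have c: "h f \<in> carrier S" for f using ring_hom_closed[OF h] by simp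
  have "h f = h (f - g) \<oplus>\<^bsub>S\<^esub> h g" using ring_hom_add[OF h, of "f-g" g] by simp
  thus ?thesis using c by (simp add: a_minus_def S.a_assoc S.r_neg)
qed

section \<open>Presenting \<open>\<H>\<close> as a quotient of the free algebra\<close>

text \<open>
  Third isomorphism theorem for generated ideals: the image of \<open>Idl (S \<union> S')\<close> is an ideal of the
  first quotient that contains the images of \<open>S'\<close>, and the preimage of the ideal generated by these
  images is an ideal of \<open>R\<close> that contains \<open>S \<union> S'\<close>.
\<close>

lemma (in ring) quot_genideal_coset_eq_zero_iff:
  assumes S: "S \<subseteq> carrier R" and S': "S' \<subseteq> carrier R" and x: "x \<in> carrier R"
  defines "I \<equiv> Idl S"
  defines "Q \<equiv> R Quot I"
  shows "(Idl\<^bsub>Q\<^esub> ((+>) I ` S')) +>\<^bsub>Q\<^esub> (I +> x) = \<zero>\<^bsub>Q Quot (Idl\<^bsub>Q\<^esub> ((+>) I ` S'))\<^esub>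
         \<longleftrightarrow> x \<in> Idl (S \<union> S')"
proof -
  have I: "ideal I R" unfolding I_def by (rule genideal_ideal[OF S])
  interpret I: ideal I R by (rule I)
  have Q: "ring Q" unfolding Q_def by (rule I.quotient_is_ring)
  interpret Q: ring Q by (rule Q)
  have \<pi>: "(+>) I \<in> ring_hom R Q" unfolding Q_def by (rule I.rcos_ring_hom)
  interpret \<pi>: ring_hom_ring R Q "(+>) I"
    unfolding Q_def by (rule I.rcos_ring_hom_ring)
  let ?S = "(+>) I ` S'"
  have S'Q: "?S \<subseteq> carrier Q" using S' \<pi>.hom_closed by auto
  let ?J = "Idl\<^bsub>Q\<^esub> ?S"
  have J: "ideal ?J Q" by (rule Q.genideal_ideal[OF S'Q])
  interpret J: ideal ?J Q by (rule J)
  have SS: "S \<union> S' \<subseteq> carrier R" using S S' by auto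
  have K: "ideal (Idl (S \<union> S')) R" by (rule genideal_ideal[OF SS])
  have "?J +>\<^bsub>Q\<^esub> (I +> x) = \<zero>\<^bsub>Q Quot ?J\<^esub> \<longleftrightarrow> I +> x \<in> ?J"
    using J.rcos_const_imp_mem Q.a_rcos_zero[OF J] \<pi>.hom_closed[OF x]
    by (auto simp: FactRing_def)
  also have "\<dots> \<longleftrightarrow> x \<in> Idl (S \<union> S')"
  proof
    assume *: "I +> x \<in> ?J"
    have "ideal ((+>) I ` (Idl (S \<union> S'))) Q"
      unfolding Q_def by (rule ring_ideal_imp_quot_ideal[OF I K])
    moreover have "?S \<subseteq> (+>) I ` (Idl (S \<union> S'))" using genideal_self[OF SS] by auto
    ultimately have "?J \<subseteq> (+>) I ` (Idl (S \<union> S'))" by (rule Q.genideal_minimal)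
    with * obtain y where y: "y \<in> Idl (S \<union> S')" "I +> x = I +> y" by auto
    interpret K: ideal "Idl (S \<union> S')" R by (rule K)
    have yc: "y \<in> carrier R" using y(1) by (rule K.Icarr)
    have "x \<ominus> y \<in> I" using quotient_eq_iff_same_a_r_cos[OF I x yc] y(2) by simp
    moreover have "I \<subseteq> Idl (S \<union> S')"
      unfolding I_def using genideal_self[OF SS] by (intro genideal_minimal[OF K]) auto
    ultimately have "x \<ominus> y \<in> Idl (S \<union> S')" by blast
    hence "(x \<ominus> y) \<oplus> y \<in> Idl (S \<union> S')" by (rule K.a_closed[OF _ y(1)])
    thus "x \<in> Idl (S \<union> S')" using x yc by (simp add: a_minus_def a_assoc l_neg)
  next
    assume *: "x \<in> Idl (S \<union> S')"
    have "ideal {r \<in> carrier R. I +> r \<in> ?J} R" by (rule \<pi>.ideal_vimage[OF J])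
    moreover have "S \<union> S' \<subseteq> {r \<in> carrier R. I +> r \<in> ?J}"
    proof
      fix r assume r: "r \<in> S \<union> S'"
      hence rc: "r \<in> carrier R" using SS by auto
      show "r \<in> {r \<in> carrier R. I +> r \<in> ?J}"
      proof (cases "r \<in> S'")
        case True
        thus ?thesis using rc Q.genideal_self[OF S'Q] by auto
      next
        case False
        hence "r \<in> I" using r genideal_self[OF S] I_def by auto
        hence "I +> r = I" by (rule a_rcos_zero[OF I])
        also have "\<dots> = \<zero>\<^bsub>Q\<^esub>" unfolding Q_def FactRing_def by simp
        finally show ?thesis using rc J.zero_closed by simp
      qed
    qed
    ultimately have "Idl (S \<union> S') \<subseteq> {r \<in> carrier R. I +> r \<in> ?J}" by (rule genideal_minimal)
    thus "I +> x \<in> ?J" using * by auto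
  qed
  finally show ?thesis .
qed

text \<open>
  \<open>\<H>\<close> is a quotient of a quotient of the free algebra. Lifting its relations to the free algebra
  makes it a single quotient, so that identities in \<open>\<H>\<close> become memberships in one ideal of a
  type-class ring, where ring normalization applies.
\<close>

definition lifted_hecke_rels ::
  "('k::field \<Rightarrow> 'a::ring_1 \<Rightarrow> 'a) \<Rightarrow> ('a \<Rightarrow> ('a \<times> 'a \<Rightarrow>\<^sub>0 'k) set) \<Rightarrow>
   ('k \<Rightarrow> 'v::ab_group_add \<Rightarrow> 'v) \<Rightarrow> ('a \<Rightarrow> 'v \<Rightarrow> 'v) \<Rightarrow>
   (('a \<times> 'v \<Rightarrow>\<^sub>0 'k) set \<Rightarrow> 'a) \<Rightarrow> (('v \<times> 'v \<Rightarrow>\<^sub>0 'k) set \<Rightarrow> 'v \<times> 'a) \<Rightarrow>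
   (('v \<times> 'a) fword \<Rightarrow>\<^sub>0 'k) set" where
  "lifted_hecke_rels sA \<Delta> sV act lam kap =
     {letter (0, a) * letter (0, b) - letter (0, a * b) | a b. True} \<union>
     {letter (0, 1) - 1} \<union>
     {letter (0, a) * letter (v, 0)
        - (\<Sum>p\<in>Poly_Mapping.keys d.
              letter (sV (Poly_Mapping.lookup d p) (act (fst p) v), 0) * letter (0, snd p))
        - letter (0, lam (pure_tensor sA sV a v)) | a v d. d \<in> \<Delta> a} \<union>
     {letter (v, 0) * letter (w, 0) - letter (w, 0) * letter (v, 0) - letter (kap (wedge sV v w))
        | v w. True}"

definition hecke_ideal ::
  "('k::field \<Rightarrow> 'a::ring_1 \<Rightarrow> 'a) \<Rightarrow> ('a \<Rightarrow> ('a \<times> 'a \<Rightarrow>\<^sub>0 'k) set) \<Rightarrow>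
   ('k \<Rightarrow> 'v::ab_group_add \<Rightarrow> 'v) \<Rightarrow> ('a \<Rightarrow> 'v \<Rightarrow> 'v) \<Rightarrow>
   (('a \<times> 'v \<Rightarrow>\<^sub>0 'k) set \<Rightarrow> 'a) \<Rightarrow> (('v \<times> 'v \<Rightarrow>\<^sub>0 'k) set \<Rightarrow> 'v \<times> 'a) \<Rightarrow>
   (('v \<times> 'a) fword \<Rightarrow>\<^sub>0 'k) set" where
  "hecke_ideal sA \<Delta> sV act lam kap =
     Idl\<^bsub>free_algebra\<^esub> (linear_rels (sum_scale sV sA) \<union> lifted_hecke_rels sA \<Delta> sV act lam kap)"

lemma ideal_linear_rels: "ideal (Idl\<^bsub>free_algebra\<^esub> linear_rels s) free_algebra"
  by (rule FA.genideal_ideal) simp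

lemma ring_tensor_algebra: "ring (tensor_algebra s)"
  unfolding tensor_algebra_def by (rule ideal.quotient_is_ring[OF ideal_linear_rels])

lemma tensor_algebra_class_hom: "tensor_algebra_class s \<in> ring_hom free_algebra (tensor_algebra s)"
proof -
  have "tensor_algebra_class s = (+>\<^bsub>free_algebra\<^esub>) (Idl\<^bsub>free_algebra\<^esub> linear_rels s)"
    by (rule ext) (simp add: tensor_algebra_class_def)
  thus ?thesis unfolding tensor_algebra_def
    using ideal.rcos_ring_hom[OF ideal_linear_rels] by simp
qed

lemma hecke_rels_lifted:
  "hecke_rels sA \<Delta> sV act lam kap =
     tensor_algebra_class (sum_scale sV sA) ` lifted_hecke_rels sA \<Delta> sV act lam kap"
proof -
  let ?h = "tensor_algebra_class (sum_scale sV sA)"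
  note T = ring_tensor_algebra[of "sum_scale sV sA"]
  note h = tensor_algebra_class_hom[of "sum_scale sV sA"]
  have hm: "?h (f * g) = ?h f \<otimes>\<^bsub>tensor_algebra (sum_scale sV sA)\<^esub> ?h g" for f g
    using ring_hom_mult[OF h] by simp
  have h1: "?h 1 = \<one>\<^bsub>tensor_algebra (sum_scale sV sA)\<^esub>"
    using ring_hom_one[OF h] by simp
  show ?thesis
    unfolding hecke_rels_def lifted_hecke_rels_def Let_def image_Un
    apply (intro arg_cong2[of _ _ _ _ "(\<union>)"])
    subgoal by (force simp: image_iff tensor_incl_def hom_minus[OF T h] hm)
    subgoal by (simp add: tensor_incl_def hom_minus[OF T h] hm h1)
    subgoal by (force simp: image_iff tensor_incl_def hom_minus[OF T h] hm hom_finsum[OF T h])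
    subgoal by (force simp: image_iff tensor_incl_def hom_minus[OF T h] hm)
    done
qed

context
  fixes sA :: "'k::field \<Rightarrow> 'a::ring_1 \<Rightarrow> 'a"
    and \<Delta> :: "'a \<Rightarrow> ('a \<times> 'a \<Rightarrow>\<^sub>0 'k) set"
    and sV :: "'k \<Rightarrow> 'v::ab_group_add \<Rightarrow> 'v"
    and act :: "'a \<Rightarrow> 'v \<Rightarrow> 'v"
    and lam :: "('a \<times> 'v \<Rightarrow>\<^sub>0 'k) set \<Rightarrow> 'a"
    and kap :: "('v \<times> 'v \<Rightarrow>\<^sub>0 'k) set \<Rightarrow> 'v \<times> 'a"
begin

private abbreviation "T \<equiv> tensor_algebra (sum_scale sV sA)"
private abbreviation "H \<equiv> hecke_algebra sA \<Delta> sV act lam kap"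
private abbreviation "\<pi> \<equiv> hecke_class sA \<Delta> sV act lam kap"
private abbreviation "N \<equiv> hecke_ideal sA \<Delta> sV act lam kap"

lemma ideal_hecke_rels: "ideal (Idl\<^bsub>T\<^esub> hecke_rels sA \<Delta> sV act lam kap) T"
proof -
  interpret T: ring T by (rule ring_tensor_algebra)
  show ?thesis
    using ring_hom_closed[OF tensor_algebra_class_hom[of "sum_scale sV sA"]]
    by (intro T.genideal_ideal) (auto simp: hecke_rels_lifted)
qed

lemma ring_hecke_algebra: "ring H"
  unfolding hecke_algebra_def Let_def by (rule ideal.quotient_is_ring[OF ideal_hecke_rels])

lemma hecke_class_hom: "\<pi> \<in> ring_hom free_algebra H"
proof -
  have "\<pi> = (+>\<^bsub>T\<^esub>) (Idl\<^bsub>T\<^esub> hecke_rels sA \<Delta> sV act lam kap) \<circ> tensor_algebra_class (sum_scale sV sA)"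
    by (rule ext) (simp add: hecke_class_def Let_def)
  thus ?thesis unfolding hecke_algebra_def Let_def
    using ring_hom_trans[OF tensor_algebra_class_hom ideal.rcos_ring_hom[OF ideal_hecke_rels]] by simp
qed

lemma hecke_class_eq_iff: "\<pi> f = \<pi> g \<longleftrightarrow> f - g \<in> N"
proof -
  interpret H: ring H by (rule ring_hecke_algebra)
  have c: "\<pi> f \<in> carrier H" for f using ring_hom_closed[OF hecke_class_hom] by simp
  have "\<pi> f = \<pi> g \<longleftrightarrow> \<pi> (f - g) = \<zero>\<^bsub>H\<^esub>"
    using H.r_right_minus_eq[OF c c, of f g]
    by (simp add: hom_minus[OF ring_hecke_algebra hecke_class_hom])
  also have "\<dots> \<longleftrightarrow> f - g \<in> N"
    unfolding hecke_class_def hecke_algebra_def Let_def hecke_rels_lifted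
    using FA.quot_genideal_coset_eq_zero_iff[of "linear_rels (sum_scale sV sA)"
        "lifted_hecke_rels sA \<Delta> sV act lam kap" "f - g"]
    unfolding tensor_algebra_def tensor_algebra_class_def hecke_ideal_def
    by simp
  finally show ?thesis .
qed

lemma ideal_hecke_ideal: "ideal N free_algebra"
  unfolding hecke_ideal_def by (rule FA.genideal_ideal) simp

lemma hecke_ideal_minus: "f \<in> N \<Longrightarrow> g \<in> N \<Longrightarrow> f - g \<in> N"
  and hecke_ideal_add: "f \<in> N \<Longrightarrow> g \<in> N \<Longrightarrow> f + g \<in> N"
  and hecke_ideal_mult_left: "f \<in> N \<Longrightarrow> h * f \<in> N"
  and hecke_ideal_mult_right: "f \<in> N \<Longrightarrow> f * h \<in> N"
proof -
  interpret N: ideal N free_algebra by (rule ideal_hecke_ideal)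
  show "f \<in> N \<Longrightarrow> g \<in> N \<Longrightarrow> f - g \<in> N"
    using N.a_closed[OF _ N.a_inv_closed, of f g] by (simp add: a_inv_free_algebra)
  show "f \<in> N \<Longrightarrow> g \<in> N \<Longrightarrow> f + g \<in> N"
    using N.a_closed[of f g] by simp
  show "f \<in> N \<Longrightarrow> h * f \<in> N" "f \<in> N \<Longrightarrow> f * h \<in> N"
    using N.I_l_closed[of f h] N.I_r_closed[of f h] by simp_all
qed

lemma hecke_ideal_rels:
  "linear_rels (sum_scale sV sA) \<subseteq> N" "lifted_hecke_rels sA \<Delta> sV act lam kap \<subseteq> N"
  using FA.genideal_self[of "linear_rels (sum_scale sV sA) \<union> lifted_hecke_rels sA \<Delta> sV act lam kap"]
  unfolding hecke_ideal_def by auto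

text \<open>
  The tool for showing that an element of \<open>\<H>\<close> is nonzero, by exhibiting an ideal that contains the
  relations but not a lift of the element.
\<close>

lemma hecke_ideal_minimal:
  assumes "ideal J free_algebra" "linear_rels (sum_scale sV sA) \<subseteq> J"
    and "lifted_hecke_rels sA \<Delta> sV act lam kap \<subseteq> J"
  shows "N \<subseteq> J"
  unfolding hecke_ideal_def using assms by (intro FA.genideal_minimal) auto

end

section \<open>Homogeneous elements of an associated graded ring\<close>

locale filtered_ring = ring R for R (structure) +
  fixes F :: "nat \<Rightarrow> 'a set"
  assumes filt_subgroup: "additive_subgroup (F n) R"
    and filt_Suc: "F n \<subseteq> F (Suc n)"
    and filt_mult: "x \<in> F i \<Longrightarrow> y \<in> F j \<Longrightarrow> x \<otimes> y \<in> F (i + j)"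
begin

abbreviation "below \<equiv> filt_below R F"

lemma below_subgroup: "abelian_subgroup (below n) R"
proof (rule abelian_subgroupI3)
  show "additive_subgroup (below n) R"
    by (cases n) (simp_all add: filt_below_def filt_subgroup additive_subgroup.intro
        add.triv_subgroup)
qed (rule is_abelian_group)

lemma filt_carrier: "x \<in> F n \<Longrightarrow> x \<in> carrier R"
  using additive_subgroup.a_subset[OF filt_subgroup] by blast

lemma below_filt: "x \<in> below n \<Longrightarrow> x \<in> F n"
  using filt_Suc additive_subgroup.zero_closed[OF filt_subgroup]
  by (cases n) (auto simp: filt_below_def)

lemma below_mult_left:
  assumes x: "x \<in> below i" and y: "y \<in> F j" shows "x \<otimes> y \<in> below (i + j)"
proof (cases i)
  case 0
  hence "x = \<zero>" using x by (simp add: filt_below_def)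
  thus ?thesis using filt_carrier[OF y]
      additive_subgroup.zero_closed[OF abelian_subgroup.axioms(1)[OF below_subgroup]] by simp
next
  case (Suc m)
  thus ?thesis using filt_mult[of x m y j] x y by (simp add: filt_below_def)
qed

lemma below_mult_right:
  assumes x: "x \<in> F i" and y: "y \<in> below j" shows "x \<otimes> y \<in> below (i + j)"
proof (cases j)
  case 0
  hence "y = \<zero>" using y by (simp add: filt_below_def)
  thus ?thesis using filt_carrier[OF x]
      additive_subgroup.zero_closed[OF abelian_subgroup.axioms(1)[OF below_subgroup]] by simp
next
  case (Suc m)
  thus ?thesis using filt_mult[of x i y m] x y by (simp add: filt_below_def)
qed

lemma below_zero: "\<zero> \<in> below n"
  and below_add: "x \<in> below n \<Longrightarrow> y \<in> below n \<Longrightarrow> x \<oplus> y \<in> below n"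
  and below_carrier: "x \<in> below n \<Longrightarrow> x \<in> carrier R"
proof -
  interpret B: abelian_subgroup "below n" R by (rule below_subgroup)
  show "\<zero> \<in> below n" "x \<in> below n \<Longrightarrow> y \<in> below n \<Longrightarrow> x \<oplus> y \<in> below n"
    "x \<in> below n \<Longrightarrow> x \<in> carrier R"
    using B.zero_closed B.a_closed B.a_Hcarr by blast+
qed

lemma below_finsum:
  assumes "finite I" "\<And>k. k \<in> I \<Longrightarrow> t k \<in> below n"
  shows "(\<Oplus>k\<in>I. t k) \<in> below n"
  using assms
proof (induction I)
  case (insert k I)
  have "t \<in> I \<rightarrow> carrier R" "t k \<in> carrier R" using insert.prems below_carrier by auto
  thus ?case using insert by (simp add: below_add)
qed (simp add: below_zero)

lemma below_coset_iff:
  assumes "x \<in> carrier R"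
  shows "y \<in> below n +> x \<longleftrightarrow> (\<exists>b\<in>below n. y = b \<oplus> x)"
  by (auto simp: a_r_coset_def r_coset_def)

lemma below_coset_eqI:
  assumes "x \<in> carrier R" "y \<in> below n +> x"
  shows "below n +> y = below n +> x"
  using a_repr_independence[OF assms(2,1) additive_subgroup.a_subgroup]
    abelian_subgroup.axioms(1)[OF below_subgroup] by simp

lemma homog_alt: "homog R F d x n = below n +> (if n = d then x else \<zero>)"
proof -
  interpret B: abelian_subgroup "below n" R by (rule below_subgroup)
  show ?thesis using a_coset_add_zero[OF B.a_subset] by (simp add: homog_def)
qed

lemma homog_rep_filt:
  assumes x: "x \<in> F d" and y: "y \<in> homog R F d x n" shows "y \<in> F n"
proof -
  have c: "(if n = d then x else \<zero>) \<in> F n"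
    using x additive_subgroup.zero_closed[OF filt_subgroup] by simp
  then obtain b where "b \<in> below n" "y = b \<oplus> (if n = d then x else \<zero>)"
    using y unfolding homog_alt below_coset_iff[OF filt_carrier[OF c]] by blast
  thus ?thesis using c below_filt additive_subgroup.a_closed[OF filt_subgroup] by simp
qed

text \<open>
  A product of representatives has in degree \<open>n\<close> the summands \<open>p k \<otimes> q (n - k)\<close>. Unless \<open>k = i\<close> and
  \<open>n - k = j\<close>, one factor lies one filtration step below its index, hence so does the summand. The
  exceptional summand differs from \<open>x \<otimes> y\<close> by an element of lower filtration.
\<close>

lemma homog_mult_rep:
  assumes x: "x \<in> F i" and y: "y \<in> F j"
    and p: "\<And>k. p k \<in> homog R F i x k" and q: "\<And>k. q k \<in> homog R F j y k"
  shows "(\<Oplus>k\<in>{..n}. p k \<otimes> q (n - k)) \<in> homog R F (i + j) (x \<otimes> y) n"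
proof -
  have pF: "p k \<in> F k" and qF: "q k \<in> F k" for k
    using homog_rep_filt[OF x p] homog_rep_filt[OF y q] .
  note pc = filt_carrier[OF pF] and qc = filt_carrier[OF qF]
  have xy: "x \<in> carrier R" "y \<in> carrier R" using x y filt_carrier by auto
  have off: "p k \<otimes> q (n - k) \<in> below n" if "k \<le> n" "k \<noteq> i \<or> n - k \<noteq> j" for k
  proof (cases "k = i")
    case False
    hence "p k \<in> below k" using p[of k] by (simp add: homog_def)
    from below_mult_left[OF this qF[of "n - k"]] show ?thesis using that by simp
  next
    case True
    hence "q (n - k) \<in> below (n - k)" using that q[of "n - k"] by (simp add: homog_def)
    from below_mult_right[OF pF[of k] this] show ?thesis using that by simp
  qed
  show ?thesis
  proof (cases "n = i + j")
    case False
    have "(\<Oplus>k\<in>{..n}. p k \<otimes> q (n - k)) \<in> below n"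
      using False by (intro below_finsum) (auto intro!: off)
    thus ?thesis using False by (simp add: homog_def)
  next
    case True
    obtain b where b: "b \<in> below i" "p i = b \<oplus> x"
      using p[of i] xy by (auto simp: homog_def below_coset_iff)
    obtain c where c: "c \<in> below j" "q j = c \<oplus> y"
      using q[of j] xy by (auto simp: homog_def below_coset_iff)
    have bc: "b \<in> carrier R" "c \<in> carrier R" using b c below_carrier by auto
    let ?r = "\<Oplus>k\<in>{..n} - {i}. p k \<otimes> q (n - k)"
    have r: "?r \<in> below n" by (intro below_finsum) (auto intro!: off)
    have "{..n} = insert i ({..n} - {i})" using True by auto
    hence "(\<Oplus>k\<in>{..n}. p k \<otimes> q (n - k)) = (\<Oplus>k\<in>insert i ({..n} - {i}). p k \<otimes> q (n - k))" by simp
    also have "\<dots> = p i \<otimes> q (n - i) \<oplus> ?r" using pc qc by (subst finsum_insert) auto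
    also have "\<dots> = (b \<oplus> x) \<otimes> q j \<oplus> ?r" using b True by simp
    also have "\<dots> = (b \<otimes> q j \<oplus> x \<otimes> c \<oplus> ?r) \<oplus> x \<otimes> y"
      using bc xy below_carrier[OF r] unfolding c(2)
      by (simp add: l_distr r_distr a_ac)
    finally have eq: "(\<Oplus>k\<in>{..n}. p k \<otimes> q (n - k)) = (b \<otimes> q j \<oplus> x \<otimes> c \<oplus> ?r) \<oplus> x \<otimes> y" .
    have "b \<otimes> q j \<oplus> x \<otimes> c \<oplus> ?r \<in> below n"
      using below_mult_left[OF b(1) qF[of j]] below_mult_right[OF x c(1)] r True
      by (simp add: below_add)
    thus ?thesis unfolding eq using True xy by (auto simp: homog_def below_coset_iff)
  qed
qed

lemma homog_mult:
  assumes x: "x \<in> F i" and y: "y \<in> F j"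
  shows "homog R F i x \<otimes>\<^bsub>assoc_graded R F\<^esub> homog R F j y = homog R F (i + j) (x \<otimes> y)"
proof
  fix n
  let ?C = "homog R F (i + j) (x \<otimes> y) n"
  let ?\<Sigma> = "\<lambda>p q. \<Oplus>k\<in>{..n}. p k \<otimes> q (n - k)"
  let ?A = "{below n +> ?\<Sigma> p q | p q.
      (\<forall>k. p k \<in> homog R F i x k) \<and> (\<forall>k. q k \<in> homog R F j y k)}"
  have xy: "x \<otimes> y \<in> carrier R" using x y filt_carrier by auto
  have rep: "below n +> ?\<Sigma> p q = ?C"
    if "\<And>k. p k \<in> homog R F i x k" "\<And>k. q k \<in> homog R F j y k" for p q
    using homog_mult_rep[OF x y that, of n] xy unfolding homog_alt
    by (intro below_coset_eqI) auto
  have ex: "\<exists>p. \<forall>k. p k \<in> homog R F d z k" if "z \<in> F d" for d z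
  proof (intro exI allI)
    fix k
    have c: "(if k = d then z else \<zero>) \<in> carrier R" using filt_carrier[OF that] by simp
    thus "(if k = d then z else \<zero>) \<in> homog R F d z k"
      unfolding homog_alt below_coset_iff[OF c] by (intro bexI[OF _ below_zero]) simp
  qed
  have "?A = {?C}"
  proof (intro equalityI subsetI)
    fix X assume "X \<in> ?A"
    then obtain p q where "X = below n +> ?\<Sigma> p q"
      "\<forall>k. p k \<in> homog R F i x k" "\<forall>k. q k \<in> homog R F j y k" by blast
    thus "X \<in> {?C}" using rep[of p q] by simp
  next
    fix X assume "X \<in> {?C}"
    moreover obtain p q where pq: "\<forall>k. p k \<in> homog R F i x k" "\<forall>k. q k \<in> homog R F j y k"
      using ex[OF x] ex[OF y] by blast
    ultimately have "X = below n +> ?\<Sigma> p q" using rep[of p q] by simp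
    thus "X \<in> ?A" using pq by blast
  qed
  hence "\<Union>?A = ?C" by simp
  thus "(homog R F i x \<otimes>\<^bsub>assoc_graded R F\<^esub> homog R F j y) n = ?C"
    by (simp add: assoc_graded_def)
qed

lemma homog_add:
  assumes "x \<in> carrier R" "y \<in> carrier R"
  shows "homog R F i x \<oplus>\<^bsub>assoc_graded R F\<^esub> homog R F i y = homog R F i (x \<oplus> y)"
proof
  fix n
  interpret B: abelian_subgroup "below n" R by (rule below_subgroup)
  show "(homog R F i x \<oplus>\<^bsub>assoc_graded R F\<^esub> homog R F i y) n = homog R F i (x \<oplus> y) n"
    using assms B.a_rcos_sum[of "if n = i then x else \<zero>" "if n = i then y else \<zero>"]
    by (simp add: assoc_graded_def homog_alt)
qed

lemma homog_zero: "homog R F i \<zero> = homog R F j \<zero>"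
  by (rule ext) (simp add: homog_alt)

lemma homog_eqI:
  assumes "x \<in> carrier R" "y \<in> carrier R" "x \<ominus> y \<in> below i"
  shows "homog R F i x = homog R F i y"
proof -
  have "x = (x \<ominus> y) \<oplus> y" using assms by (simp add: a_minus_def a_assoc l_neg)
  hence "x \<in> below i +> y" using assms by (auto simp: below_coset_iff)
  hence "below i +> x = below i +> y" using assms by (intro below_coset_eqI) auto
  thus ?thesis by (intro ext) (simp add: homog_def)
qed

end

section \<open>The filtration of \<open>\<H>\<close>\<close>

lemma V_degree_add: "V_degree (u + w) = V_degree u + V_degree w"
  by (simp add: V_degree_def plus_fword_def)

definition V_degree_le :: "nat \<Rightarrow> (('v::zero \<times> 'a) fword \<Rightarrow>\<^sub>0 'k::field) set" where
  "V_degree_le n = {f. \<forall>w\<in>Poly_Mapping.keys f. V_degree w \<le> n}"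

lemma V_degree_le_add: "f \<in> V_degree_le n \<Longrightarrow> g \<in> V_degree_le n \<Longrightarrow> f + g \<in> V_degree_le n"
  using Poly_Mapping.keys_add[of f g] by (auto simp: V_degree_le_def)

lemma V_degree_le_uminus: "f \<in> V_degree_le n \<Longrightarrow> - f \<in> V_degree_le n"
  by (simp add: V_degree_le_def in_keys_iff)

lemma V_degree_le_mult: "f \<in> V_degree_le m \<Longrightarrow> g \<in> V_degree_le n \<Longrightarrow> f * g \<in> V_degree_le (m + n)"
  using Poly_Mapping.keys_mult[of f g] by (fastforce simp: V_degree_le_def V_degree_add)

lemma V_degree_le_zero: "0 \<in> V_degree_le n"
  by (simp add: V_degree_le_def)

lemma V_degree_le_letter:
  "letter (0, a) \<in> V_degree_le 0" "letter (v, 0) \<in> V_degree_le 1"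
  by (simp_all add: V_degree_le_def V_degree_def)

lemma filtered_hecke_algebra:
  "filtered_ring (hecke_algebra sA \<Delta> sV act lam kap) (hecke_filtration sA \<Delta> sV act lam kap)"
proof -
  let ?H = "hecke_algebra sA \<Delta> sV act lam kap"
  let ?\<pi> = "hecke_class sA \<Delta> sV act lam kap"
  interpret H: ring ?H by (rule ring_hecke_algebra)
  note \<pi> = hecke_class_hom[of sA \<Delta> sV act lam kap]
  have F: "hecke_filtration sA \<Delta> sV act lam kap n = ?\<pi> ` V_degree_le n" for n
    by (simp add: hecke_filtration_def V_degree_le_def)
  have add: "?\<pi> (f + g) = ?\<pi> f \<oplus>\<^bsub>?H\<^esub> ?\<pi> g" and mult: "?\<pi> (f * g) = ?\<pi> f \<otimes>\<^bsub>?H\<^esub> ?\<pi> g"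
    and c: "?\<pi> f \<in> carrier ?H" for f g
    using ring_hom_add[OF \<pi>, of f g] ring_hom_mult[OF \<pi>, of f g] ring_hom_closed[OF \<pi>] by auto
  have zero: "?\<pi> 0 = \<zero>\<^bsub>?H\<^esub>" using ring_hom_zero[OF \<pi> ring_free_algebra ring_hecke_algebra] by simp
  have neg: "\<ominus>\<^bsub>?H\<^esub> ?\<pi> f = ?\<pi> (- f)" for f
    using hom_minus[OF ring_hecke_algebra \<pi>, of 0 f] c by (simp add: zero a_minus_def)
  show ?thesis
  proof (intro filtered_ring.intro filtered_ring_axioms.intro ring_hecke_algebra
      additive_subgroup.intro, goal_cases)
    case (1 n)
    show ?case
    proof (rule H.add.subgroupI)
      show "hecke_filtration sA \<Delta> sV act lam kap n \<noteq> {}"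
        using V_degree_le_zero F by blast
      show "\<And>a. a \<in> hecke_filtration sA \<Delta> sV act lam kap n \<Longrightarrow>
         \<ominus>\<^bsub>?H\<^esub> a \<in> hecke_filtration sA \<Delta> sV act lam kap n"
        unfolding F by (auto simp: neg intro!: imageI V_degree_le_uminus)
      show "\<And>a b. a \<in> hecke_filtration sA \<Delta> sV act lam kap n \<Longrightarrow>
         b \<in> hecke_filtration sA \<Delta> sV act lam kap n \<Longrightarrow>
         a \<oplus>\<^bsub>?H\<^esub> b \<in> hecke_filtration sA \<Delta> sV act lam kap n"
        unfolding F by (auto simp: add[symmetric] intro!: imageI V_degree_le_add)
    qed (use c F in auto)
  next
    case (2 n)
    show ?case unfolding F by (intro image_mono) (auto simp: V_degree_le_def)
  next
    case (3 x i y j)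
    thus ?case unfolding F by (auto simp: mult[symmetric] intro!: imageI V_degree_le_mult)
  qed
qed

section \<open>Linear extension and tensor products\<close>

lemma poly_mapping_sum_single: "f = (\<Sum>x\<in>Poly_Mapping.keys f. Poly_Mapping.single x (Poly_Mapping.lookup f x))"
  by (rule poly_mapping_eqI) (simp add: lookup_sum lookup_single when_def in_keys_iff)

lemma keys_fscale_subset: "Poly_Mapping.keys (fscale c f) \<subseteq> Poly_Mapping.keys f"
  by (auto simp: in_keys_iff)

context vector_space
begin

lemma free_ext_superset:
  "finite X \<Longrightarrow> Poly_Mapping.keys d \<subseteq> X \<Longrightarrow>
     free_ext scale h d = (\<Sum>x\<in>X. scale (Poly_Mapping.lookup d x) (h x))"
  unfolding free_ext_def by (rule sum.mono_neutral_left) (auto simp: in_keys_iff)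

lemma free_ext_zero [simp]: "free_ext scale h 0 = 0"
  by (simp add: free_ext_def)

lemma free_ext_single [simp]: "free_ext scale h (Poly_Mapping.single x c) = scale c (h x)"
  by (simp add: free_ext_superset[of "{x}"])

lemma free_ext_add: "free_ext scale h (d + e) = free_ext scale h d + free_ext scale h e"
proof -
  let ?X = "Poly_Mapping.keys d \<union> Poly_Mapping.keys e"
  show ?thesis using Poly_Mapping.keys_add[of d e]
    by (simp add: free_ext_superset[of ?X] lookup_add scale_left_distrib sum.distrib)
qed

lemma free_ext_fscale: "free_ext scale h (fscale c d) = scale c (free_ext scale h d)"
  using keys_fscale_subset[of c d]
  by (simp add: free_ext_superset[of "Poly_Mapping.keys d"] scale_sum_right)

lemma free_ext_diff: "free_ext scale h (d - e) = free_ext scale h d - free_ext scale h e"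
  using free_ext_add[of h "d - e" e] by simp

lemma free_ext_sum: "free_ext scale h (\<Sum>i\<in>I. d i) = (\<Sum>i\<in>I. free_ext scale h (d i))"
  by (induction I rule: infinite_finite_induct) (auto simp: free_ext_add)

lemma free_ext_fun_add:
  "free_ext scale (\<lambda>x. h x + h' x) d = free_ext scale h d + free_ext scale h' d"
  by (simp add: free_ext_def scale_right_distrib sum.distrib)

lemma free_ext_fun_scale: "free_ext scale (\<lambda>x. scale c (h x)) d = scale c (free_ext scale h d)"
  by (simp add: free_ext_def scale_sum_right mult.commute)

lemma free_ext_fun_zero [simp]: "free_ext scale (\<lambda>x. 0) d = 0"
  by (simp add: free_ext_def)

lemma free_ext_comp:
  "free_ext scale h (free_ext fscale g d) = free_ext scale (\<lambda>x. free_ext scale h (g x)) d"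
  unfolding free_ext_def[of fscale] by (simp add: free_ext_sum free_ext_fscale free_ext_def[of scale _ d])

lemma free_ext_mult:
  "free_ext scale h (f * g) = free_ext scale (\<lambda>u. free_ext scale (\<lambda>w. h (u + w)) g) f"
proof -
  have "f * g = (\<Sum>u\<in>Poly_Mapping.keys f. \<Sum>w\<in>Poly_Mapping.keys g.
      Poly_Mapping.single (u + w) (Poly_Mapping.lookup f u * Poly_Mapping.lookup g w))"
    by (subst poly_mapping_sum_single[of f], subst poly_mapping_sum_single[of g])
       (simp add: sum_product mult_single)
  hence "free_ext scale h (f * g) = (\<Sum>u\<in>Poly_Mapping.keys f. \<Sum>w\<in>Poly_Mapping.keys g.
      scale (Poly_Mapping.lookup f u * Poly_Mapping.lookup g w) (h (u + w)))"
    by (simp add: free_ext_sum)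
  thus ?thesis by (simp add: free_ext_def scale_sum_right)
qed

end

lemma free_ext_hom:
  fixes L :: "'m::ab_group_add \<Rightarrow> 'n::ab_group_add" and h :: "'x \<Rightarrow> 'm"
  assumes "\<And>x y. L (x + y) = L x + L y" "\<And>c x. L (s c x) = t c (L x)" "L 0 = 0"
  shows "L (free_ext s h d) = free_ext t (\<lambda>x. L (h x)) d"
proof -
  have "L (\<Sum>x\<in>X. g x) = (\<Sum>x\<in>X. L (g x))" for X and g :: "'x \<Rightarrow> 'm"
    by (induction X rule: infinite_finite_induct) (auto simp: assms)
  thus ?thesis by (simp add: free_ext_def assms(2))
qed

definition bilin ::
  "('k \<Rightarrow> 'a \<Rightarrow> 'a) \<Rightarrow> ('k \<Rightarrow> 'b \<Rightarrow> 'b) \<Rightarrow> ('k \<Rightarrow> 'm \<Rightarrow> 'm) \<Rightarrow>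
   ('a::plus \<Rightarrow> 'b::plus \<Rightarrow> 'm::plus) \<Rightarrow> bool" where
  "bilin s t r B \<longleftrightarrow>
     (\<forall>x x' y. B (x + x') y = B x y + B x' y) \<and> (\<forall>x y y'. B x (y + y') = B x y + B x y') \<and>
     (\<forall>c x y. B (s c x) y = r c (B x y)) \<and> (\<forall>c x y. B x (t c y) = r c (B x y))"

text \<open>
  The universal property of the tensor product: a bilinear map has the same linear extension on any
  two expressions of a tensor.
\<close>

lemma (in vector_space) free_ext_tensor_rel:
  assumes B: "bilin s t scale B" and d: "d \<in> tensor_rel s t"
  shows "free_ext scale (\<lambda>(x, y). B x y) d = 0"
proof -
  let ?K = "{d. free_ext scale (\<lambda>(x, y). B x y) d = 0}"
  have "tensor_rel s t \<subseteq> ?K"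
    unfolding tensor_rel_def
    by (rule free_vs.span_minimal)
       (use B in \<open>auto simp: bilin_def free_vs.subspace_def free_ext_add free_ext_diff free_ext_fscale\<close>)
  thus ?thesis using d by auto
qed

lemma tensor_rel_diff: "d \<in> tensor_rel s t \<Longrightarrow> e \<in> tensor_rel s t \<Longrightarrow> d - e \<in> tensor_rel s t"
  and tensor_rel_add: "d \<in> tensor_rel s t \<Longrightarrow> e \<in> tensor_rel s t \<Longrightarrow> d + e \<in> tensor_rel s t"
  and tensor_rel_zero: "0 \<in> tensor_rel s t"
  by (simp_all add: tensor_rel_def free_vs.span_diff free_vs.span_add free_vs.span_zero)

lemma mem_tensor_class: "f \<in> tensor_class s t f"
  by (simp add: tensor_class_def tensor_rel_zero)

lemma tensor_class_eq: "g \<in> tensor_class s t f \<Longrightarrow> tensor_class s t g = tensor_class s t f"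
proof -
  assume "g \<in> tensor_class s t f"
  hence gf: "g - f \<in> tensor_rel s t" by (simp add: tensor_class_def)
  have "x - g \<in> tensor_rel s t \<longleftrightarrow> x - f \<in> tensor_rel s t" for x
    using tensor_rel_add[OF _ gf, of "x - g"] tensor_rel_diff[OF _ gf, of "x - f"] by auto
  thus ?thesis by (simp add: tensor_class_def)
qed

lemma tensor_class_add: "tensor_class s t f + tensor_class s t g = tensor_class s t (f + g)"
proof (intro equalityI subsetI)
  fix x assume "x \<in> tensor_class s t f + tensor_class s t g"
  then obtain y z where "y - f \<in> tensor_rel s t" "z - g \<in> tensor_rel s t" "x = y + z"
    by (auto simp: set_plus_def tensor_class_def)
  thus "x \<in> tensor_class s t (f + g)"
    using tensor_rel_add[of "y - f" s t "z - g"] by (simp add: tensor_class_def algebra_simps)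
next
  fix x assume "x \<in> tensor_class s t (f + g)"
  hence "x - g \<in> tensor_class s t f" by (simp add: tensor_class_def algebra_simps)
  moreover have "x = (x - g) + g" by simp
  ultimately show "x \<in> tensor_class s t f + tensor_class s t g"
    using mem_tensor_class[of g s t] unfolding set_plus_def by blast
qed

section \<open>Modules over the free algebra\<close>

text \<open>
  Operators \<open>op x\<close> on \<open>'m\<close> make it a module over the free algebra. The relations of interest hold
  only on the invariant subspace \<open>M0\<close>; working with a subspace avoids a type for it.
\<close>

locale letter_action = vector_space scale
  for scale :: "'k::field \<Rightarrow> 'm::ab_group_add \<Rightarrow> 'm" +
  fixes op :: "'x \<Rightarrow> 'm \<Rightarrow> 'm" and M0 :: "'m set"
  assumes op_add: "op x (m + m') = op x m + op x m'"
    and op_scale: "op x (scale c m) = scale c (op x m)"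
    and M0_subspace: "subspace M0"
    and M0_op: "m \<in> M0 \<Longrightarrow> op x m \<in> M0"
begin

definition word_action :: "'x fword \<Rightarrow> 'm \<Rightarrow> 'm" where
  "word_action w = foldr op (letters w)"

definition rep :: "('x fword \<Rightarrow>\<^sub>0 'k) \<Rightarrow> 'm \<Rightarrow> 'm" where
  "rep h m = free_ext scale (\<lambda>w. word_action w m) h"

definition annihilator :: "('x fword \<Rightarrow>\<^sub>0 'k) set" where
  "annihilator = {h. \<forall>m\<in>M0. rep h m = 0}"

lemma op_zero: "op x 0 = 0"
  using op_scale[of x 0 0] by simp

lemma word_action_add: "word_action w (m + m') = word_action w m + word_action w m'"
  and word_action_scale: "word_action w (scale c m) = scale c (word_action w m)"
  and word_action_zero: "word_action w 0 = 0"
proof -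
  have "foldr op xs (m + m') = foldr op xs m + foldr op xs m'"
    "foldr op xs (scale c m) = scale c (foldr op xs m)" "foldr op xs 0 = 0" for xs
    by (induction xs) (auto simp: op_add op_scale op_zero)
  thus "word_action w (m + m') = word_action w m + word_action w m'"
    "word_action w (scale c m) = scale c (word_action w m)" "word_action w 0 = 0"
    by (simp_all add: word_action_def)
qed

lemma word_action_M0: "m \<in> M0 \<Longrightarrow> word_action w m \<in> M0"
proof -
  assume m: "m \<in> M0"
  have "foldr op xs m \<in> M0" for xs by (induction xs) (auto simp: m M0_op)
  thus ?thesis by (simp add: word_action_def)
qed

lemma rep_M0: "m \<in> M0 \<Longrightarrow> rep h m \<in> M0"
  unfolding rep_def free_ext_def
  by (intro subspace_sum subspace_scale M0_subspace word_action_M0)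

lemma rep_mult: "rep (f * g) m = rep f (rep g m)"
proof -
  have "word_action u (rep g m) = free_ext scale (\<lambda>w. word_action (u + w) m) g" for u
    unfolding rep_def
    using free_ext_hom[where L = "word_action u" and s = scale and t = scale]
    by (simp add: word_action_add word_action_scale word_action_zero)
       (simp add: word_action_def plus_fword_def)
  thus ?thesis by (simp add: rep_def[of f] rep_def[of "f * g"] free_ext_mult)
qed

lemma rep_zero [simp]: "rep h 0 = 0"
  by (simp add: rep_def word_action_zero)

lemma rep_zero_left [simp]: "rep 0 m = 0"
  and rep_add: "rep (f + g) m = rep f m + rep g m"
  and rep_diff: "rep (f - g) m = rep f m - rep g m"
  and rep_fscale: "rep (fscale c f) m = scale c (rep f m)"
  and rep_sum: "rep (\<Sum>i\<in>I. h i) m = (\<Sum>i\<in>I. rep (h i) m)"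
  by (simp_all add: rep_def free_ext_add free_ext_diff free_ext_fscale free_ext_sum)

lemma rep_letter [simp]: "rep (letter x) m = op x m"
  and rep_one [simp]: "rep 1 m = m"
  by (simp_all add: rep_def word_action_def zero_fword_def flip: single_one)

lemma ideal_annihilator: "ideal annihilator free_algebra"
  by (rule ideal_free_algebraI) (auto simp: annihilator_def rep_diff rep_mult rep_M0)

end

section \<open>Sweedler sums\<close>

context bialgebra
begin

lemma coprod_obtain: obtains d where "d \<in> \<Delta> a"
  using coprod_tensor[of a] mem_tensor_class by blast

lemma coprod_eq_class: "d \<in> \<Delta> a \<Longrightarrow> \<Delta> a = tensor_class scale scale d"
  using coprod_tensor[of a] tensor_class_eq by blast

text \<open>
  \<open>\<Sum> B(a\<^sub>1, a\<^sub>2)\<close>; the chosen expression of \<open>\<Delta> a\<close> does not matter when \<open>B\<close> is bilinear.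
\<close>

definition sweedler :: "('k \<Rightarrow> 'm::ab_group_add \<Rightarrow> 'm) \<Rightarrow> ('a \<Rightarrow> 'a \<Rightarrow> 'm) \<Rightarrow> 'a \<Rightarrow> 'm" where
  "sweedler r B a = free_ext r (\<lambda>(x, y). B x y) (SOME d. d \<in> \<Delta> a)"

lemma sweedler_eq:
  assumes r: "vector_space r" and B: "bilin scale scale r B" and d: "d \<in> \<Delta> a"
  shows "sweedler r B a = free_ext r (\<lambda>(x, y). B x y) d"
proof -
  have "(SOME d. d \<in> \<Delta> a) \<in> \<Delta> a" using d by (rule someI)
  hence "(SOME d. d \<in> \<Delta> a) - d \<in> tensor_rel scale scale"
    using coprod_eq_class[OF d] by (auto simp: tensor_class_def)
  from vector_space.free_ext_tensor_rel[OF r B this] show ?thesis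
    by (simp add: sweedler_def vector_space.free_ext_diff[OF r])
qed

lemma sweedler_add:
  assumes r: "vector_space r" and B: "bilin scale scale r B"
  shows "sweedler r B (a + b) = sweedler r B a + sweedler r B b"
proof -
  obtain d e where d: "d \<in> \<Delta> a" and e: "e \<in> \<Delta> b" using coprod_obtain by metis
  hence "d + e \<in> \<Delta> (a + b)" unfolding coprod_add by (rule set_plus_intro)
  from sweedler_eq[OF r B this] sweedler_eq[OF r B d] sweedler_eq[OF r B e] show ?thesis
    by (simp add: vector_space.free_ext_add[OF r])
qed

lemma sweedler_scale:
  assumes r: "vector_space r" and B: "bilin scale scale r B"
  shows "sweedler r B (scale c a) = r c (sweedler r B a)"
proof -
  obtain d where d: "d \<in> \<Delta> a" using coprod_obtain by metis
  show ?thesis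
    by (simp add: sweedler_eq[OF r B coprod_scale[OF d]] sweedler_eq[OF r B d]
        vector_space.free_ext_fscale[OF r])
qed

lemma sweedler_zero:
  assumes r: "vector_space r" and B: "bilin scale scale r B"
  shows "sweedler r B 0 = 0"
  using sweedler_add[OF r B, of 0 0] by simp

lemma sweedler_one:
  assumes r: "vector_space r" and B: "bilin scale scale r B"
  shows "sweedler r B 1 = B 1 1"
proof -
  interpret r: vector_space r by (rule r)
  have "gen (1, 1) \<in> \<Delta> 1" unfolding coprod_one pure_tensor_def by (rule mem_tensor_class)
  from sweedler_eq[OF r B this] show ?thesis by simp
qed

lemma sweedler_mult:
  assumes r: "vector_space r" and B: "bilin scale scale r B"
  shows "sweedler r B (a * b) = sweedler r (\<lambda>x y. sweedler r (\<lambda>x' y'. B (x * x') (y * y')) b) a"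
proof -
  interpret r: vector_space r by (rule r)
  obtain d e where d: "d \<in> \<Delta> a" and e: "e \<in> \<Delta> b" using coprod_obtain by metis
  have B1: "bilin scale scale r (\<lambda>x' y'. B (x * x') (y * y'))" for x y
    using B by (simp add: bilin_def distrib_left scale_mult_right)
  have "bilin scale scale r (\<lambda>x y. free_ext r (\<lambda>(x', y'). B (x * x') (y * y')) e)"
    using B unfolding bilin_def
    by (simp add: case_prod_unfold distrib_right scale_mult_left
        r.free_ext_fun_add r.free_ext_fun_scale)
  note B2 = sweedler_eq[OF r this d]
  show ?thesis
    unfolding sweedler_eq[OF r B1 e] B2 sweedler_eq[OF r B coprod_mult[OF d e]]
    by (simp add: r.free_ext_comp case_prod_unfold)
qed

end

lemma sum_apply: "(\<Sum>i\<in>I. f i) x = (\<Sum>i\<in>I. f i x)"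
  for f :: "'i \<Rightarrow> 'b \<Rightarrow> 'c::comm_monoid_add"
  by (induction I rule: infinite_finite_induct) auto

section \<open>The truncated smash product\<close>

locale bialgebra_module = bialgebra sA \<Delta> \<epsilon> + algebra_module sA sV act
  for sA :: "'k::field \<Rightarrow> 'a::ring_1 \<Rightarrow> 'a" and \<Delta> \<epsilon>
    and sV :: "'k \<Rightarrow> 'v::ab_group_add \<Rightarrow> 'v" and act
begin

definition linear_form :: "('a \<Rightarrow> 'k) \<Rightarrow> bool" where
  "linear_form f \<longleftrightarrow> (\<forall>x y. f (x + y) = f x + f y) \<and> (\<forall>c x. f (sA c x) = c * f x)"

lemma linear_form_zero: "linear_form f \<Longrightarrow> f 0 = 0"
  unfolding linear_form_def by (metis mult_zero_left scale_zero_left)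

lemma linear_form_mult: "linear_form f \<Longrightarrow> linear_form (\<lambda>z. f (y * z))"
  by (simp add: linear_form_def distrib_left scale_mult_right)

lemma act_vadd: "act a (v + w) = act a v + act a w"
  and act_vscale: "act a (sV c v) = sV c (act a v)"
  using act_linear[of a] by (simp_all add: Vector_Spaces.linear_def module_hom_def module_hom_axioms_def)

lemma act_vzero: "act a 0 = 0"
  using act_vscale[of a 0 0] by simp

text \<open>
  The smash product modulo \<open>Sym\<close>-degree 2 and above is \<open>A \<oplus> (V \<otimes> A)\<close>. An element \<open>\<Sum> v \<otimes> a\<close> of
  \<open>V \<otimes> A\<close> is encoded by the map \<open>f \<mapsto> \<Sum> f(a) v\<close> on linear forms \<open>f\<close> on \<open>A\<close>. This encoding replaces the
  cosets of a tensor product by functions, and evaluation at \<open>f\<close> is the map \<open>id \<otimes> f\<close> that is wanted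
  in the end.
\<close>

definition trunc_scale :: "'k \<Rightarrow> 'a \<times> (('a \<Rightarrow> 'k) \<Rightarrow> 'v) \<Rightarrow> 'a \<times> (('a \<Rightarrow> 'k) \<Rightarrow> 'v)" where
  "trunc_scale c m = (sA c (fst m), \<lambda>f. sV c (snd m f))"

text \<open>
  In tensor notation \<open>v + a\<close> sends \<open>(b, t)\<close> to \<open>(a b, v \<otimes> b + a t)\<close>, where
  \<open>a (w \<otimes> b) = \<Sum> a\<^sub>1(w) \<otimes> a\<^sub>2 b\<close>. The value 0 at maps that are not linear keeps \<open>trunc_act\<close> additive in
  its second argument on the whole type.
\<close>

definition trunc_act :: "'v \<times> 'a \<Rightarrow> 'a \<times> (('a \<Rightarrow> 'k) \<Rightarrow> 'v) \<Rightarrow> 'a \<times> (('a \<Rightarrow> 'k) \<Rightarrow> 'v)" where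
  "trunc_act p m =
     (snd p * fst m,
      \<lambda>f. if linear_form f then sV (f (fst m)) (fst p)
            + sweedler sV (\<lambda>x y. act x (snd m (\<lambda>z. f (y * z)))) (snd p) else 0)"

text \<open>
  The pairs whose second component is linear on linear forms. Only for these is the Sweedler sum in
  \<open>trunc_act\<close> taken over a bilinear map, hence independent of the expression of the coproduct.
\<close>

definition trunc :: "('a \<times> (('a \<Rightarrow> 'k) \<Rightarrow> 'v)) set" where
  "trunc = {m. (\<forall>f g. linear_form f \<longrightarrow> linear_form g \<longrightarrow> snd m (\<lambda>z. f z + g z) = snd m f + snd m g) \<and>
               (\<forall>c f. linear_form f \<longrightarrow> snd m (\<lambda>z. c * f z) = sV c (snd m f)) \<and>
               (\<forall>f. \<not> linear_form f \<longrightarrow> snd m f = 0)}"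

lemma trunc_bilin:
  assumes "m \<in> trunc" "linear_form f"
  shows "bilin sA sA sV (\<lambda>x y. act x (snd m (\<lambda>z. f (y * z))))"
proof -
  have "snd m (\<lambda>z. f ((y + y') * z)) = snd m (\<lambda>z. f (y * z)) + snd m (\<lambda>z. f (y' * z))" for y y'
  proof -
    have "(\<lambda>z. f ((y + y') * z)) = (\<lambda>z. f (y * z) + f (y' * z))"
      using assms(2) by (simp add: linear_form_def distrib_right)
    thus ?thesis using assms linear_form_mult[of f] by (simp add: trunc_def)
  qed
  moreover have "snd m (\<lambda>z. f (sA c y * z)) = sV c (snd m (\<lambda>z. f (y * z)))" for c y
  proof -
    have "(\<lambda>z. f (sA c y * z)) = (\<lambda>z. c * f (y * z))"
      using assms(2) by (simp add: linear_form_def scale_mult_left)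
    thus ?thesis using assms linear_form_mult[of f] by (simp add: trunc_def)
  qed
  ultimately show ?thesis
    by (simp add: bilin_def act_add act_scale act_vadd act_vscale)
qed

lemma sweedler_fun_add: "sweedler sV (\<lambda>x y. B x y + B' x y) a = sweedler sV B a + sweedler sV B' a"
  and sweedler_fun_scale: "sweedler sV (\<lambda>x y. sV c (B x y)) a = sV c (sweedler sV B a)"
  by (simp_all add: sweedler_def case_prod_unfold V.free_ext_fun_add V.free_ext_fun_scale)

lemma act_sweedler: "act b (sweedler sV B a) = sweedler sV (\<lambda>x y. act b (B x y)) a"
  unfolding sweedler_def
  by (subst free_ext_hom[where L = "act b" and t = sV])
     (simp_all add: act_vadd act_vscale act_vzero case_prod_unfold)

lemma vector_space_trunc_scale: "vector_space trunc_scale"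
  by unfold_locales (auto simp: trunc_scale_def scale_right_distrib scale_left_distrib
      V.scale_right_distrib V.scale_left_distrib prod_eq_iff)

lemma fst_trunc_act [simp]: "fst (trunc_act p m) = snd p * fst m"
  by (simp add: trunc_act_def)

lemma trunc_act_closed:
  assumes m: "m \<in> trunc" shows "trunc_act p m \<in> trunc"
proof -
  have add: "snd m (\<lambda>z. f (y * z) + g (y * z)) = snd m (\<lambda>z. f (y * z)) + snd m (\<lambda>z. g (y * z))"
    if "linear_form f" "linear_form g" for f g y
    using m linear_form_mult[OF that(1)] linear_form_mult[OF that(2)] by (simp add: trunc_def)
  have scale: "snd m (\<lambda>z. c * f (y * z)) = sV c (snd m (\<lambda>z. f (y * z)))" if "linear_form f" for c f y
    using m linear_form_mult[OF that] by (simp add: trunc_def)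
  have lin_add: "linear_form (\<lambda>z. f z + g z)" if "linear_form f" "linear_form g" for f g
    using that by (simp add: linear_form_def algebra_simps)
  have lin_scale: "linear_form (\<lambda>z. c * f z)" if "linear_form f" for c f
    using that by (simp add: linear_form_def algebra_simps)
  show ?thesis
    by (simp add: trunc_def trunc_act_def add scale lin_add lin_scale act_vadd act_vscale
        sweedler_fun_add sweedler_fun_scale V.scale_left_distrib V.scale_right_distrib)
qed

sublocale trunc: letter_action trunc_scale trunc_act trunc
proof (rule letter_action.intro[OF vector_space_trunc_scale], unfold_locales)
  show "trunc_act p (m + m') = trunc_act p m + trunc_act p m'" for p m m'
    by (auto simp: trunc_act_def prod_eq_iff fun_eq_iff distrib_left linear_form_def V.scale_left_distrib
        act_vadd sweedler_fun_add)
  show "trunc_act p (trunc_scale c m) = trunc_scale c (trunc_act p m)" for p c m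
    by (auto simp: trunc_act_def trunc_scale_def prod_eq_iff fun_eq_iff scale_mult_right linear_form_def
        act_vscale sweedler_fun_scale V.scale_right_distrib)
  have "Modules.module trunc_scale" using vector_space_trunc_scale by (simp add: module_iff_vector_space)
  thus "module.subspace trunc_scale trunc"
    by (auto simp: module.subspace_def trunc_def trunc_scale_def V.scale_right_distrib
        V.scale_left_commute)
qed (rule trunc_act_closed)

lemma trunc_act_V:
  assumes "m \<in> trunc"
  shows "trunc_act (v, 0) m = (0, \<lambda>f. if linear_form f then sV (f (fst m)) v else 0)"
  using sweedler_zero[OF V.vector_space_axioms trunc_bilin[OF assms]]
  by (auto simp: trunc_act_def)

lemma trunc_act_A:
  "trunc_act (0, a) m = (a * fst m,
     \<lambda>f. if linear_form f then sweedler sV (\<lambda>x y. act x (snd m (\<lambda>z. f (y * z)))) a else 0)"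
  by (auto simp: trunc_act_def)

lemma trunc_act_zero: "m \<in> trunc \<Longrightarrow> trunc_act (0, 0) m = 0"
  by (auto simp: trunc_act_V prod_eq_iff fun_eq_iff)

lemma trunc_act_linear:
  assumes m: "m \<in> trunc"
  shows "trunc_act (p + q) m = trunc_act p m + trunc_act q m"
    and "trunc_act (sum_scale sV sA c p) m = trunc_scale c (trunc_act p m)"
  using sweedler_add[OF V.vector_space_axioms trunc_bilin[OF m]]
    sweedler_scale[OF V.vector_space_axioms trunc_bilin[OF m]]
  by (auto simp: trunc_act_def trunc_scale_def sum_scale_def prod_eq_iff fun_eq_iff distrib_right
      V.scale_right_distrib scale_mult_left V.scale_left_commute)

lemma trunc_act_mult:
  assumes m: "m \<in> trunc"
  shows "trunc_act (0, a) (trunc_act (0, b) m) = trunc_act (0, a * b) m"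
  using sweedler_mult[OF V.vector_space_axioms trunc_bilin[OF m], of _ a b]
  by (auto simp: trunc_act_A fun_eq_iff mult.assoc linear_form_mult act_sweedler act_mult)

lemma trunc_act_one: "m \<in> trunc \<Longrightarrow> trunc_act (0, 1) m = m"
  using sweedler_one[OF V.vector_space_axioms trunc_bilin[of m]]
  by (auto simp: trunc_act_A prod_eq_iff fun_eq_iff act_one trunc_def)

text \<open>
  The smash product relation \<open>a v = \<Sum> a\<^sub>1(v) a\<^sub>2\<close>: both sides send \<open>(b, t)\<close> to
  \<open>(0, \<Sum> a\<^sub>1(v) \<otimes> a\<^sub>2 b)\<close>, since \<open>V\<close> kills \<open>V \<otimes> A\<close>.
\<close>

lemma trunc_act_commute:
  assumes m: "m \<in> trunc" and d: "d \<in> \<Delta> a"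
  shows "trunc_act (0, a) (trunc_act (v, 0) m) =
         (\<Sum>p\<in>Poly_Mapping.keys d. trunc_act (sV (Poly_Mapping.lookup d p) (act (fst p) v), 0)
            (trunc_act (0, snd p) m))"
proof -
  have V: "trunc_act (v, 0) (trunc_act (0, b) m) = (0, \<lambda>f. if linear_form f then sV (f (b * fst m)) v else 0)"
    for v b using trunc_act_V[OF trunc.M0_op[OF m], of v "(0, b)"] by (simp cong: if_cong)
  have "sweedler sV (\<lambda>x y. sV (f (y * fst m)) (act x v)) a =
      (\<Sum>p\<in>Poly_Mapping.keys d. sV (f (snd p * fst m)) (sV (Poly_Mapping.lookup d p) (act (fst p) v)))"
    if f: "linear_form f" for f
  proof -
    have "bilin sA sA sV (\<lambda>x y. sV (f (y * fst m)) (act x v))"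
      using f by (auto simp: bilin_def linear_form_def act_add act_scale V.scale_right_distrib
          V.scale_left_distrib distrib_right scale_mult_left V.scale_left_commute)
    thus ?thesis
      by (simp add: sweedler_eq[OF V.vector_space_axioms _ d] free_ext_def case_prod_unfold
          V.scale_left_commute mult.commute)
  qed
  thus ?thesis
    unfolding V
    by (auto simp: trunc_act_V[OF m] trunc_act_A prod_eq_iff fst_sum snd_sum sum_apply fun_eq_iff
        linear_form_mult act_vscale linear_form_zero)
qed

lemma hecke_ideal_annihilates:
  "hecke_ideal sA \<Delta> sV act (\<lambda>_. 0) (\<lambda>_. (0, 0)) \<subseteq> trunc.annihilator"
proof (rule hecke_ideal_minimal[OF trunc.ideal_annihilator])
  show "linear_rels (sum_scale sV sA) \<subseteq> trunc.annihilator"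
    using trunc_act_linear
    by (fastforce simp: linear_rels_def trunc.annihilator_def trunc.rep_diff trunc.rep_fscale)
  \<comment> \<open>The product of two vectors has degree 2, so it acts by zero and commutators vanish.\<close>
  have VV: "trunc_act (v, 0) (trunc_act (w, 0) m) = 0" if "m \<in> trunc" for v w m
    using trunc_act_V[OF trunc.M0_op[OF that], of v "(w, 0)"] that
    by (auto simp: trunc_act_V prod_eq_iff fun_eq_iff linear_form_zero)
  show "lifted_hecke_rels sA \<Delta> sV act (\<lambda>_. 0) (\<lambda>_. (0, 0)) \<subseteq> trunc.annihilator"
    unfolding lifted_hecke_rels_def trunc.annihilator_def
    by (auto simp: trunc.rep_diff trunc.rep_mult trunc.rep_sum trunc_act_mult trunc_act_one
        trunc_act_commute trunc_act_zero VV)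
qed

text \<open>
  On the smash product, \<open>id \<otimes> f\<close> applied to the component in \<open>V \<otimes> A\<close>, read off from the image of 1.
\<close>

definition degree_one_part :: "('a \<Rightarrow> 'k) \<Rightarrow> (('v \<times> 'a) fword \<Rightarrow>\<^sub>0 'k) \<Rightarrow> 'v" where
  "degree_one_part f h = snd (trunc.rep h (1, 0)) f"

lemma one_trunc: "(1, 0) \<in> trunc"
  by (simp add: trunc_def)

lemma degree_one_part_add: "degree_one_part f (h + h') = degree_one_part f h + degree_one_part f h'"
  and degree_one_part_diff: "degree_one_part f (h - h') = degree_one_part f h - degree_one_part f h'"
  and degree_one_part_sum: "degree_one_part f (\<Sum>i\<in>I. g i) = (\<Sum>i\<in>I. degree_one_part f (g i))"
  by (simp_all add: degree_one_part_def trunc.rep_add trunc.rep_diff trunc.rep_sum snd_sum sum_apply)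

lemma degree_one_part_va:
  "linear_form f \<Longrightarrow> degree_one_part f (letter (v, 0) * letter (0, a)) = sV (f a) v"
  using trunc_act_V[OF trunc.M0_op[OF one_trunc], of v "(0, a)"]
  by (simp add: degree_one_part_def trunc.rep_mult trunc_act_A)

lemma degree_one_part_hecke_ideal:
  "h \<in> hecke_ideal sA \<Delta> sV act (\<lambda>_. 0) (\<lambda>_. (0, 0)) \<Longrightarrow> degree_one_part f h = 0"
  using hecke_ideal_annihilates one_trunc
  by (auto simp: degree_one_part_def trunc.annihilator_def)

end

section \<open>The Jacobi identity\<close>

text \<open>
  The normal form \<open>\<Sum> a\<^sub>1(v) a\<^sub>2\<close> of the leading term of \<open>a v\<close>, for an expression \<open>d\<close> of \<open>\<Delta> a\<close>.
\<close>

definition ordered_sweedler ::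
  "('k::field \<Rightarrow> 'v \<Rightarrow> 'v) \<Rightarrow> ('a \<Rightarrow> 'v \<Rightarrow> 'v) \<Rightarrow> 'v \<Rightarrow> ('a \<times> 'a \<Rightarrow>\<^sub>0 'k) \<Rightarrow>
   (('v::ab_group_add \<times> 'a::ring_1) fword \<Rightarrow>\<^sub>0 'k)" where
  "ordered_sweedler sV act v d =
     (\<Sum>p\<in>Poly_Mapping.keys d.
        letter (sV (Poly_Mapping.lookup d p) (act (fst p) v), 0) * letter (0, snd p))"

lemma hecke_class_letter_zero:
  "hecke_class sA \<Delta> sV act lam kap (letter (0, 0)) = hecke_class sA \<Delta> sV act lam kap 0"
proof -
  have "letter (0 + 0) - letter 0 - letter 0 \<in> linear_rels (sum_scale sV sA)"
    unfolding linear_rels_def by blast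
  hence "- letter 0 \<in> hecke_ideal sA \<Delta> sV act lam kap" using subsetD[OF hecke_ideal_rels(1)] by simp
  from hecke_ideal_mult_left[OF this, of "-1"] show ?thesis
    by (simp add: hecke_class_eq_iff zero_prod_def)
qed

text \<open>
  Lifts of the elements of \<open>V \<otimes> A\<close>. Scalars need no separate rule, as they can be absorbed into \<open>v\<close>.
\<close>

inductive_set ordered_degree_one :: "(('v::zero \<times> 'a::zero) fword \<Rightarrow>\<^sub>0 'k::field) set" where
  zero: "0 \<in> ordered_degree_one"
| add_product: "f \<in> ordered_degree_one \<Longrightarrow> letter (v, 0) * letter (0, a) + f \<in> ordered_degree_one"

lemma ordered_degree_one_add: "f \<in> ordered_degree_one \<Longrightarrow> g \<in> ordered_degree_one \<Longrightarrow> f + g \<in> ordered_degree_one"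
  by (induction rule: ordered_degree_one.induct) (auto simp: add.assoc intro: ordered_degree_one.intros)

lemma ordered_degree_one_product: "letter (v, 0) * letter (0, a) \<in> ordered_degree_one"
  using ordered_degree_one.add_product[OF ordered_degree_one.zero] by simp

lemma ordered_degree_one_sweedler: "ordered_sweedler sV act v d \<in> ordered_degree_one"
proof -
  have "(\<Sum>p\<in>I. letter (u p, 0) * letter (0, b p)) \<in> ordered_degree_one" for I and u :: "_ \<Rightarrow> 'v::zero" and b
    by (induction I rule: infinite_finite_induct) (auto intro: ordered_degree_one.intros)
  thus ?thesis by (simp add: ordered_sweedler_def)
qed

text \<open>
  The PBW isomorphism sends the class of an element of \<open>ordered_degree_one\<close> in the smash product to
  the class, in degree 1 of the associated graded ring, of the same expression in \<open>\<H>\<close>. If \<open>L\<close> and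
  \<open>R\<close> differ in \<open>\<H>\<close> by an element of filtration degree 0, these classes agree, and injectivity gives
  \<open>L = R\<close> in the smash product.
\<close>

lemma PBW_detects_degree_one:
  assumes PBW: "PBW_property sA \<Delta> sV act lam kap"
    and L: "L \<in> ordered_degree_one" and R: "R \<in> ordered_degree_one" and h: "h \<in> V_degree_le 0"
    and rel: "L - R - h \<in> hecke_ideal sA \<Delta> sV act lam kap"
  shows "L - R \<in> hecke_ideal sA \<Delta> sV act (\<lambda>_. 0) (\<lambda>_. (0, 0))"
proof -
  let ?G = "hecke_algebra sA \<Delta> sV act (\<lambda>_. 0) (\<lambda>_. (0, 0))"
  let ?\<rho> = "hecke_class sA \<Delta> sV act (\<lambda>_. 0) (\<lambda>_. (0, 0))"
  let ?H = "hecke_algebra sA \<Delta> sV act lam kap"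
  let ?\<pi> = "hecke_class sA \<Delta> sV act lam kap"
  let ?F = "hecke_filtration sA \<Delta> sV act lam kap"
  let ?gr = "assoc_graded ?H ?F"
  note h0 = hecke_class_hom[of sA \<Delta> sV act "\<lambda>_. 0" "\<lambda>_. (0, 0)"]
  note h1 = hecke_class_hom[of sA \<Delta> sV act lam kap]
  interpret H: filtered_ring ?H ?F by (rule filtered_hecke_algebra)
  have c0: "?\<rho> f \<in> carrier ?G" and c1: "?\<pi> f \<in> carrier ?H" for f
    using ring_hom_closed[OF h0] ring_hom_closed[OF h1] by simp_all
  have F: "?\<pi> f \<in> ?F n" if "f \<in> V_degree_le n" for f n
    using that by (auto simp: hecke_filtration_def V_degree_le_def)
  obtain \<phi> where \<phi>: "\<phi> \<in> ring_iso ?G ?gr"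
    and \<phi>V: "\<And>v. \<phi> (?\<rho> (letter (v, 0))) = homog ?H ?F 1 (?\<pi> (letter (v, 0)))"
    and \<phi>A: "\<And>a. \<phi> (?\<rho> (letter (0, a))) = homog ?H ?F 0 (?\<pi> (letter (0, a)))"
    using PBW unfolding PBW_property_def Let_def by blast
  have hom: "\<phi> \<in> ring_hom ?G ?gr" and inj: "inj_on \<phi> (carrier ?G)"
    using \<phi> by (auto simp: ring_iso_def bij_betw_def)
  have \<phi>_ordered_degree_one: "\<phi> (?\<rho> f) = homog ?H ?F 1 (?\<pi> f)" if "f \<in> ordered_degree_one" for f
    using that
  proof induction
    case zero
    have z: "?\<pi> 0 = \<zero>\<^bsub>?H\<^esub>"
      using ring_hom_zero[OF h1 ring_free_algebra ring_hecke_algebra] by simp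
    \<comment> \<open>The empty sum is the image of the generator \<open>0 \<in> A\<close>, which the isomorphism is known to respect.\<close>
    have "\<phi> (?\<rho> 0) = homog ?H ?F 0 (?\<pi> 0)"
      using \<phi>A[of 0] by (simp add: hecke_class_letter_zero)
    thus ?case using H.homog_zero[of 0 1] by (simp add: z)
  next
    case (add_product s v a)
    let ?x = "letter (v, 0) * letter (0, a)"
    have "\<phi> (?\<rho> ?x) = homog ?H ?F 1 (?\<pi> (letter (v, 0))) \<otimes>\<^bsub>?gr\<^esub> homog ?H ?F 0 (?\<pi> (letter (0, a)))"
      using ring_hom_mult[OF h0, of "letter (v, 0)" "letter (0, a)"] ring_hom_mult[OF hom c0 c0]
      by (simp add: \<phi>V \<phi>A)
    also have "\<dots> = homog ?H ?F 1 (?\<pi> ?x)"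
      using H.homog_mult[OF F F, OF V_degree_le_letter(2) V_degree_le_letter(1)]
        ring_hom_mult[OF h1, of "letter (v, 0)" "letter (0, a)"] by simp
    finally have x: "\<phi> (?\<rho> ?x) = homog ?H ?F 1 (?\<pi> ?x)" .
    have "\<phi> (?\<rho> (?x + s)) = \<phi> (?\<rho> ?x) \<oplus>\<^bsub>?gr\<^esub> \<phi> (?\<rho> s)"
      using ring_hom_add[OF h0, of ?x s] ring_hom_add[OF hom c0 c0] by simp
    also have "\<dots> = homog ?H ?F 1 (?\<pi> (?x + s))"
      unfolding x add_product.IH using H.homog_add[OF c1 c1] ring_hom_add[OF h1, of ?x s] by simp
    finally show ?case by simp
  qed
  have "?\<pi> L \<ominus>\<^bsub>?H\<^esub> ?\<pi> R = ?\<pi> (L - R)"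
    by (rule hom_minus[OF ring_hecke_algebra h1, symmetric])
  also have "\<dots> = ?\<pi> h" using rel by (simp add: hecke_class_eq_iff)
  also have "\<dots> \<in> filt_below ?H ?F 1" using F[OF h] by (simp add: filt_below_def)
  finally have "homog ?H ?F 1 (?\<pi> L) = homog ?H ?F 1 (?\<pi> R)"
    by (intro H.homog_eqI c1)
  hence "\<phi> (?\<rho> L) = \<phi> (?\<rho> R)" using \<phi>_ordered_degree_one[OF L] \<phi>_ordered_degree_one[OF R] by simp
  hence "?\<rho> L = ?\<rho> R" using inj c0 by (auto dest: inj_onD)
  thus ?thesis by (simp add: hecke_class_eq_iff)
qed

text \<open>
  \<open>c\<close> and \<open>e\<close> below are the commutator relations and the relations moving \<open>k(u,w)\<close> past \<open>v\<close>. In the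
  free algebra the cyclic sum of \<open>[[u,w],v]\<close> is zero, so the cyclic sum of \<open>[c u w, v] + e v u w\<close> is
  the element in question minus the values of \<open>\<lambda>\<close>, which have degree 0.
\<close>

lemma jacobi_in_smash_product:
  fixes sA :: "'k::field \<Rightarrow> 'a::ring_1 \<Rightarrow> 'a" and sV :: "'k \<Rightarrow> 'v::ab_group_add \<Rightarrow> 'v"
    and kap :: "('v \<times> 'v \<Rightarrow>\<^sub>0 'k) set \<Rightarrow> 'v \<times> 'a"
  assumes PBW: "PBW_property sA \<Delta> sV act lam kap"
    and kap: "\<And>v w. kap (wedge sV v w) = (0, k v w)"
    and d: "\<And>v w. d v w \<in> \<Delta> (k v w)"
  shows "(letter (x, 0) * letter (0, k y z) + letter (y, 0) * letter (0, k z x)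
           + letter (z, 0) * letter (0, k x y))
         - (ordered_sweedler sV act x (d y z) + ordered_sweedler sV act y (d z x)
           + ordered_sweedler sV act z (d x y))
         \<in> hecke_ideal sA \<Delta> sV act (\<lambda>_. 0) (\<lambda>_. (0, 0))"
proof (rule PBW_detects_degree_one[OF PBW])
  let ?N = "hecke_ideal sA \<Delta> sV act lam kap"
  let ?V = "\<lambda>v. letter (v, 0) :: ('v \<times> 'a) fword \<Rightarrow>\<^sub>0 'k"
  let ?A = "\<lambda>a. letter (0, a) :: ('v \<times> 'a) fword \<Rightarrow>\<^sub>0 'k"
  let ?l = "\<lambda>v u w. ?A (lam (pure_tensor sA sV (k u w) v))"
  let ?S = "\<lambda>v u w. ordered_sweedler sV act v (d u w)"
  define c where "c = (\<lambda>v w. ?V v * ?V w - ?V w * ?V v - ?A (k v w))"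
  define e where "e = (\<lambda>v u w. ?A (k u w) * ?V v - ?S v u w - ?l v u w)"
  have c: "c v w \<in> ?N" for v w
  proof -
    have "c v w \<in> lifted_hecke_rels sA \<Delta> sV act lam kap"
      unfolding lifted_hecke_rels_def c_def kap[of v w, symmetric] by blast
    thus ?thesis by (rule subsetD[OF hecke_ideal_rels(2)])
  qed
  have e: "e v u w \<in> ?N" for v u w
  proof -
    have "e v u w \<in> lifted_hecke_rels sA \<Delta> sV act lam kap"
      unfolding lifted_hecke_rels_def e_def ordered_sweedler_def using d[of u w] by blast
    thus ?thesis by (rule subsetD[OF hecke_ideal_rels(2)])
  qed
  let ?j = "\<lambda>v u w. c u w * ?V v - ?V v * c u w + e v u w"
  have j: "?j v u w \<in> ?N" for v u w
    by (intro hecke_ideal_add hecke_ideal_minus hecke_ideal_mult_left hecke_ideal_mult_right c e)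
  have "(?V x * ?A (k y z) + ?V y * ?A (k z x) + ?V z * ?A (k x y))
      - (?S x y z + ?S y z x + ?S z x y) - (?l x y z + ?l y z x + ?l z x y)
      = ?j x y z + ?j y z x + ?j z x y"
    by (simp add: c_def e_def algebra_simps)
  also have "\<dots> \<in> ?N" by (rule hecke_ideal_add[OF hecke_ideal_add[OF j j] j])
  finally show "(?V x * ?A (k y z) + ?V y * ?A (k z x) + ?V z * ?A (k x y))
      - (?S x y z + ?S y z x + ?S z x y) - (?l x y z + ?l y z x + ?l z x y) \<in> ?N" .
qed (intro ordered_degree_one_add ordered_degree_one_product ordered_degree_one_sweedler V_degree_le_add V_degree_le_letter)+

text \<open>
  The image of the preceding identity under \<open>id \<otimes> f\<close>.
\<close>

lemma (in bialgebra_module) jacobi_identity: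
  assumes PBW: "PBW_property sA \<Delta> sV act lam kap"
    and kap: "\<And>v w. kap (wedge sV v w) = (0, k v w)"
    and d: "\<And>v w. d v w \<in> \<Delta> (k v w)"
    and f: "linear_form f"
  defines "c \<equiv> (\<lambda>x v w. free_ext sV (\<lambda>(p, q). sV (f q) (act p x)) (d v w))"
  shows "sV (f (k y z)) x + sV (f (k z x)) y + sV (f (k x y)) z = c x y z + c y z x + c z x y"
proof -
  have S: "degree_one_part f (ordered_sweedler sV act x (d v w)) = c x v w" for x v w
    by (simp add: ordered_sweedler_def degree_one_part_sum degree_one_part_va[OF f] c_def
        free_ext_def case_prod_unfold V.scale_left_commute mult.commute)
  from degree_one_part_hecke_ideal[OF jacobi_in_smash_product[OF PBW kap d], of f x y z]
  show ?thesis
    by (simp add: degree_one_part_diff degree_one_part_add degree_one_part_va[OF f] S)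
qed

section \<open>Coproducts concentrated on one pure tensor\<close>

lemma (in vector_space) free_ext_span_zero:
  assumes "u \<in> free_vs.span S" "\<And>s. s \<in> S \<Longrightarrow> free_ext scale h s = 0"
  shows "free_ext scale h u = 0"
  using assms(1)
  by (induction rule: free_vs.span_induct_alt) (simp_all add: free_ext_add free_ext_fscale assms(2))

lemma (in vector_space) complement_functional:
  assumes a: "a \<noteq> 0" and U: "subspace U"
    and inter: "span {a} \<inter> U = {0}" and sum: "span {a} + U = UNIV"
  obtains f where "\<And>x y. f (x + y) = f x + f y" "\<And>c x. f (scale c x) = c * f x"
    "f a = 1" "\<And>u. u \<in> U \<Longrightarrow> f u = 0"
proof -
  have ex: "\<exists>c. x - scale c a \<in> U" for x
  proof -
    have "x \<in> span {a} + U" using sum by simp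
    then obtain c u where "u \<in> U" "x = scale c a + u"
      by (auto simp: set_plus_def span_singleton)
    thus ?thesis by (intro exI[of _ c]) simp
  qed
  have unique: "c = c'" if "x - scale c a \<in> U" "x - scale c' a \<in> U" for x c c'
  proof -
    have "scale (c' - c) a \<in> U"
      using subspace_diff[OF U that] by (simp add: scale_left_diff_distrib)
    hence "scale (c' - c) a \<in> span {a} \<inter> U" by (simp add: span_scale span_base)
    thus ?thesis using inter a by simp
  qed
  obtain f where f: "\<And>x. x - scale (f x) a \<in> U" using ex by metis
  have fI: "f x = c" if "x - scale c a \<in> U" for x c using unique[OF f that] .
  show thesis
  proof (rule that[of f])
    show "f (x + y) = f x + f y" for x y
      using subspace_add[OF U f[of x] f[of y]] by (intro fI) (simp add: scale_left_distrib algebra_simps)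
    show "f (scale c x) = c * f x" for c x
      using subspace_scale[OF U f[of x], of c] by (intro fI) (simp add: scale_right_diff_distrib)
    show "f a = 1" by (rule fI) (simp add: subspace_0[OF U])
    show "f u = 0" if "u \<in> U" for u by (rule fI) (simp add: that)
  qed
qed

lemma (in vector_space) basis_of_two_spanned:
  assumes "R = span {v, w}"
  shows "\<exists>B. finite B \<and> card B \<le> 2 \<and> \<not> dependent B \<and> span B = R"
proof -
  obtain B where B: "B \<subseteq> {v, w}" "independent B" "{v, w} \<subseteq> span B"
    using maximal_independent_subset[of "{v, w}"] by blast
  have "finite B" "card B \<le> 2"
    using B(1) finite_subset[OF B(1)] card_mono[OF _ B(1)] card_insert_le_m1[of 2 "{w}" v] by auto
  moreover have "span B = span {v, w}"
    using B span_mono[OF B(1)] span_minimal[OF B(3) subspace_span] by auto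
  ultimately show ?thesis using B(2) assms by blast
qed

lemma tensor_span_decomposition:
  assumes "X \<in> tensor_span s t {gen (a, b)} + tensor_sub s t UNIV U"
  obtains c u where "u \<in> free_vs.span {gen (x, y) | x y. x \<in> UNIV \<and> y \<in> U}"
    "X = tensor_class s t (fscale c (gen (a, b)) + u)"
proof -
  obtain e u where e: "e \<in> free_vs.span {gen (a, b)}"
    and u: "u \<in> free_vs.span {gen (x, y) | x y. x \<in> UNIV \<and> y \<in> U}"
    and X: "X = tensor_class s t e + tensor_class s t u"
    using assms unfolding tensor_span_def tensor_sub_def by (auto elim!: set_plus_elim)
  from e obtain c where "e = fscale c (gen (a, b))" by (auto simp: free_vs.span_singleton)
  thus thesis using that[OF u] X by (simp add: tensor_class_add)
qed

text \<open>
  Both the coproduct and \<open>kap\<close> are linear, so containment in \<open>A \<otimes> U\<close> may be tested on the wedges.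
\<close>

lemma (in bialgebra) coprod_wedge_space:
  assumes kap: "tensor_linear_on sV sV (wedge_space sV) (sum_scale sV scale) kap"
    and gens: "\<And>v w. \<Delta> (snd (kap (wedge sV v w))) \<in> tensor_sub scale scale UNIV U"
    and X: "X \<in> wedge_space sV"
  shows "\<Delta> (snd (kap X)) \<in> tensor_sub scale scale UNIV U"
proof -
  let ?S = "{gen (v, w) - gen (w, v) | v w. True}"
  define T where "T = (free_vs.span {gen (x, y) | x y. x \<in> UNIV \<and> y \<in> U} :: ('a \<times> 'a \<Rightarrow>\<^sub>0 'k) set)"
  have T: "0 \<in> T" "\<And>u u' c. u \<in> T \<Longrightarrow> u' \<in> T \<Longrightarrow> fscale c u' + u \<in> T"
    unfolding T_def by (rule free_vs.span_zero) (intro free_vs.span_add free_vs.span_scale)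
  have tensor_sub: "tensor_sub scale scale UNIV U = tensor_class scale scale ` T"
    by (simp add: tensor_sub_def tensor_span_def T_def)
  let ?c = "tensor_class sV sV"
  have kap_add: "kap (X + Y) = kap X + kap Y" if "X \<in> wedge_space sV" "Y \<in> wedge_space sV" for X Y
    using kap that by (simp add: tensor_linear_on_def)
  have kap_scale: "kap (?c (fscale c s)) = sum_scale sV scale c (kap (?c s))"
    if "?c s \<in> wedge_space sV" for c s
    using kap that mem_tensor_class[of s sV sV] unfolding tensor_linear_on_def by blast
  have W: "?c s \<in> wedge_space sV" if "s \<in> free_vs.span ?S" for s
    using that by (auto simp: wedge_space_def tensor_span_def)
  obtain s where s: "s \<in> free_vs.span ?S" "X = ?c s"
    using X by (auto simp: wedge_space_def tensor_span_def)
  have "s \<in> free_vs.span ?S \<and> (\<exists>u\<in>T. u \<in> \<Delta> (snd (kap (?c s))))" using s(1)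
  proof (induction rule: free_vs.span_induct_alt)
    case base
    obtain d where "d \<in> \<Delta> (0 :: 'a)" using coprod_obtain by metis
    from coprod_scale[OF this, of 0] have "0 \<in> \<Delta> (0 :: 'a)" by simp
    moreover have k0: "snd (kap (?c 0)) = 0"
      using arg_cong[OF kap_scale[OF W[OF free_vs.span_zero], of 0], of snd]
      by (simp add: sum_scale_def)
    ultimately show ?case
      by (intro conjI bexI[of _ 0] free_vs.span_zero T(1)) simp
  next
    case (step c x y)
    obtain u where u: "u \<in> T" "u \<in> \<Delta> (snd (kap (?c y)))" using step.IH by blast
    have ys: "y \<in> free_vs.span ?S" using step.IH by blast
    obtain v w where x: "x = gen (v, w) - gen (w, v)" using step(1) by blast
    have xs: "x \<in> free_vs.span ?S" using step(1) by (rule free_vs.span_base)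
    obtain u' where u': "u' \<in> T" "\<Delta> (snd (kap (?c x))) = tensor_class scale scale u'"
      using gens[of v w] by (auto simp: tensor_sub wedge_def x)
    hence "fscale c u' \<in> \<Delta> (scale c (snd (kap (?c x))))"
      using mem_tensor_class by (intro coprod_scale) auto
    hence "fscale c u' + u \<in> \<Delta> (scale c (snd (kap (?c x))) + snd (kap (?c y)))"
      unfolding coprod_add using u(2) by (rule set_plus_intro)
    also have "scale c (snd (kap (?c x))) + snd (kap (?c y)) = snd (kap (?c (fscale c x + y)))"
      using kap_add[of "?c (fscale c x)" "?c y"] kap_scale[OF W[OF xs], of c] xs ys
      by (simp add: W free_vs.span_scale tensor_class_add sum_scale_def)
    finally show ?case
      using T(2)[OF u(1) u'(1)] free_vs.span_add[OF free_vs.span_scale[OF xs] ys] by blast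
  qed
  thus ?thesis using coprod_eq_class s(2) by (auto simp: tensor_sub)
qed

section \<open>The image of the operator\<close>

theorem proposition4p3:
  fixes sA :: "'k::field \<Rightarrow> 'a::ring_1 \<Rightarrow> 'a"
    and \<Delta> :: "'a \<Rightarrow> ('a \<times> 'a \<Rightarrow>\<^sub>0 'k) set"
    and \<epsilon> :: "'a \<Rightarrow> 'k"
    and sV :: "'k \<Rightarrow> 'v::ab_group_add \<Rightarrow> 'v"
    and act :: "'a \<Rightarrow> 'v \<Rightarrow> 'v"
    and lam :: "('a \<times> 'v \<Rightarrow>\<^sub>0 'k) set \<Rightarrow> 'a"
    and kap :: "('v \<times> 'v \<Rightarrow>\<^sub>0 'k) set \<Rightarrow> 'v \<times> 'a"
    and a' a'' :: 'a
    and U :: "'a set"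
  assumes "cocommutative_bialgebra sA \<Delta> \<epsilon>"
    and "algebra_module sA sV act"
    and "tensor_linear_on sA sV (tensor_sub sA sV UNIV UNIV) sA lam"
    and "tensor_linear_on sV sV (wedge_space sV) (sum_scale sV sA) kap"
    and "\<forall>X\<in>wedge_space sV. fst (kap X) = 0"
    and "PBW_property sA \<Delta> sV act lam kap"
    and "a' \<noteq> 0"
    and "a'' \<noteq> 0"
    and "module.subspace sA U"
    and "module.span sA {a''} \<inter> U = {0}"
    and "module.span sA {a''} + U = UNIV"
    and "\<Delta> ` (\<lambda>X. snd (kap X)) ` wedge_space sV
           \<subseteq> tensor_span sA sA {gen (a', a'')} + tensor_sub sA sA UNIV U"
    and "\<not> \<Delta> ` (\<lambda>X. snd (kap X)) ` wedge_space sV \<subseteq> tensor_sub sA sA UNIV U"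
  shows "\<exists>B. finite B \<and> card B \<le> 2 \<and> \<not> module.dependent sV B \<and>
             module.span sV B = range (\<lambda>v. act a' v - sV (\<epsilon> a') v)"
proof -
  interpret cocommutative_bialgebra sA \<Delta> \<epsilon> by fact
  interpret algebra_module sA sV act by fact
  interpret bialgebra_module sA \<Delta> \<epsilon> sV act ..
  interpret k: vector_space "(*) :: 'k \<Rightarrow> 'k \<Rightarrow> 'k" by unfold_locales (auto simp: algebra_simps)
  \<comment> \<open>The linear form that is dual to \<open>a''\<close> along the complement \<open>U\<close>.\<close>
  obtain f where f: "linear_form f" and f1: "f a'' = 1" and f0: "\<And>u. u \<in> U \<Longrightarrow> f u = 0"
    using complement_functional[OF assms(8-11)] unfolding linear_form_def by metis
  define k where "k v w = snd (kap (wedge sV v w))" for v w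
  have wedge: "wedge sV v w \<in> wedge_space sV" for v w
    unfolding wedge_def wedge_space_def tensor_span_def
    by (intro imageI free_vs.span_base) blast
  hence kap: "kap (wedge sV v w) = (0, k v w)" for v w
    using assms(5) by (simp add: k_def prod_eq_iff)
  define T where "T = (free_vs.span {gen (x, y) | x y. x \<in> UNIV \<and> y \<in> U} :: ('a \<times> 'a \<Rightarrow>\<^sub>0 'k) set)"
  have "\<exists>c u. u \<in> T \<and> \<Delta> (k v w) = tensor_class sA sA (fscale c (gen (a', a'')) + u)" for v w
  proof -
    have "\<Delta> (k v w) \<in> tensor_span sA sA {gen (a', a'')} + tensor_sub sA sA UNIV U"
      using assms(12) wedge[of v w] unfolding k_def by blast
    thus ?thesis unfolding T_def by (rule tensor_span_decomposition) blast
  qed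
  then obtain c u where u: "\<And>v w. u v w \<in> T"
    and \<Delta>k: "\<And>v w. \<Delta> (k v w) = tensor_class sA sA (fscale (c v w) (gen (a', a'')) + u v w)"
    by metis
  \<comment> \<open>A Sweedler expression of \<open>\<Delta>(k(v,w))\<close> in which only the first term is seen by \<open>id \<otimes> f\<close>.\<close>
  define d where "d v w = fscale (c v w) (gen (a', a'')) + u v w" for v w
  have d: "d v w \<in> \<Delta> (k v w)" for v w
    unfolding \<Delta>k d_def by (rule mem_tensor_class)
  have f_act: "free_ext sV (\<lambda>(p, q). sV (f q) (act p x)) (d v w) = sV (c v w) (act a' x)" for v w x
  proof -
    have "free_ext sV (\<lambda>(p, q). sV (f q) (act p x)) (u v w) = 0"
      by (rule V.free_ext_span_zero[OF u[unfolded T_def]]) (auto simp: f0)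
    thus ?thesis by (simp add: d_def V.free_ext_add V.free_ext_fscale f1)
  qed
  have f_k: "f (k v w) = c v w * \<epsilon> a'" for v w
  proof -
    have u0: "free_ext (*) (\<lambda>(x, y). \<epsilon> x * f y) (u v w) = 0"
      by (rule k.free_ext_span_zero[OF u[unfolded T_def]]) (auto simp: f0)
    have "f (k v w) = f (free_ext sA (\<lambda>(x, y). sA (\<epsilon> x) y) (d v w))"
      using counit_left[OF d] by simp
    also have "\<dots> = free_ext (*) (\<lambda>(x, y). \<epsilon> x * f y) (d v w)"
      using free_ext_hom[of f sA "(*)" "\<lambda>(x, y). sA (\<epsilon> x) y" "d v w"] f linear_form_zero[OF f]
      by (simp add: linear_form_def case_prod_unfold)
    also have "\<dots> = c v w * \<epsilon> a'"
      by (simp add: d_def k.free_ext_add k.free_ext_fscale u0 f1)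
    finally show ?thesis .
  qed
  define D where "D = (\<lambda>v. act a' v - sV (\<epsilon> a') v)"
  have jacobi: "sV (c y z) (D x) + sV (c z x) (D y) + sV (c x y) (D z) = 0" for x y z
    using jacobi_identity[OF assms(6) kap d f, of y z x]
    by (simp add: D_def f_act f_k V.scale_right_diff_distrib algebra_simps)
  have "\<exists>y z. c y z \<noteq> 0"
  proof (rule ccontr)
    assume "\<not> (\<exists>y z. c y z \<noteq> 0)"
    hence "\<Delta> (k v w) \<in> tensor_sub sA sA UNIV U" for v w
      using \<Delta>k[of v w] u[of v w] by (simp add: tensor_sub_def tensor_span_def T_def)
    from coprod_wedge_space[OF assms(4) this[unfolded k_def]] assms(13) show False by blast
  qed
  then obtain y z where yz: "c y z \<noteq> 0" by blast
  have D_add: "D (v + w) = D v + D w" and D_scale: "D (sV r v) = sV r (D v)" for v w r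
    by (simp_all add: D_def act_vadd act_vscale V.scale_right_distrib V.scale_right_diff_distrib
        V.scale_left_commute)
  have "range D = V.span {D y, D z}"
  proof (rule equalityI)
    have "D x \<in> V.span {D y, D z}" for x
    proof -
      have "sV (c y z) (D x) = - (sV (c z x) (D y) + sV (c x y) (D z))"
        using jacobi[of y z x] by (simp only: eq_neg_iff_add_eq_0 add.assoc)
      also have "\<dots> \<in> V.span {D y, D z}"
        by (intro V.span_neg V.span_add V.span_scale V.span_base) auto
      finally have "sV (inverse (c y z)) (sV (c y z) (D x)) \<in> V.span {D y, D z}"
        by (rule V.span_scale)
      thus ?thesis using yz by simp
    qed
    thus "range D \<subseteq> V.span {D y, D z}" by blast
    have "V.subspace (range D)"
      unfolding V.subspace_def
    proof (intro conjI ballI allI)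
      show "0 \<in> range D" using D_scale[of 0 0] by (intro image_eqI[of _ _ 0]) auto
    qed (auto simp: D_add[symmetric] D_scale[symmetric])
    thus "V.span {D y, D z} \<subseteq> range D" by (intro V.span_minimal) auto
  qed
  thus ?thesis unfolding D_def by (rule V.basis_of_two_spanned)
qed

end
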